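(* Let $X\subseteq\mathbb{R}^2$ be any semi-algebraic set, i.e. a set of the form $$X=\bigcup_{i=1}^{I}\bigcap_{j=1}^{J}\{(x,y)\in\mathbb{R}^2: f_{i,j}(x,y)=0,\ g_{i,j}(x,y)>0\}$$ with $f_{i,j},g_{i,j}\in\mathbb{R}[x,y]$. Then $X$ has a cell decomposition with the finiteness property.
   Context: A cell decomposition of a set $X\subseteq\mathbb{R}^2$ is a partition of $X$ into (finitely or countably many) cells, each of which is a semi-algebraic set: 0-cells are points, 1-cells are subsets homeomorphic to an open interval, 2-cells are subsets homeomorphic to an open disk. A shortest-length curve in $X$ between two points $A,B\in X$ is a piecewise $C^2$ curve $\gamma$ from $A$ to $B$ lying entirely in $X$ whose length is minimal among all piecewise $C^2$ curves in $X$ from $A$ to $B$. A geodesic line segment (relative to the decomposition) is either a straight line segment or a connected arc contained (partially or entirely) in a 1-cell. A cell decomposition $\mathcal{A}$ of $X$ has the finiteness property if for every shortest-length curve $\gamma$ in $X$ between two points of $X$ and every cell $e\in\mathcal{A}$, the set $\gamma\cap e$ is either empty or has finitely many connected components, each of which is either a singleton or a geodesic line segment. *)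

theory Defs
  imports "HOL-Analysis.Analysis"
begin

type_synonym pt = "real \<times> real"

definition poly2 :: "(pt \<Rightarrow> real) \<Rightarrow> bool" where
  "poly2 f \<longleftrightarrow> (\<exists>N::nat. \<exists>c :: nat \<Rightarrow> nat \<Rightarrow> real.
      \<forall>x y. f (x, y) = (\<Sum>i\<le>N. \<Sum>j\<le>N. c i j * x ^ i * y ^ j))"

definition semialgebraic :: "pt set \<Rightarrow> bool" where
  "semialgebraic X \<longleftrightarrow> (\<exists>(I::nat) (J::nat) (f :: nat \<Rightarrow> nat \<Rightarrow> pt \<Rightarrow> real) g.
      (\<forall>i<I. \<forall>j<J. poly2 (f i j) \<and> poly2 (g i j)) \<and>
      X = (\<Union>i<I. \<Inter>j<J. {p. f i j p = 0 \<and> g i j p > 0}))"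

definition is_cell :: "pt set \<Rightarrow> bool" where
  "is_cell e \<longleftrightarrow> semialgebraic e \<and>
     ((\<exists>p. e = {p}) \<or> e homeomorphic {0<..<(1::real)} \<or> e homeomorphic ball (0::pt) 1)"

definition one_cell :: "pt set \<Rightarrow> bool" where
  "one_cell e \<longleftrightarrow> e homeomorphic {0<..<(1::real)}"

definition cell_decomposition :: "pt set set \<Rightarrow> pt set \<Rightarrow> bool" where
  "cell_decomposition \<A> X \<longleftrightarrow>
     countable \<A> \<and> \<Union>\<A> = X \<and> (\<forall>e\<in>\<A>. e \<noteq> {} \<and> is_cell e) \<and>
     (\<forall>e1\<in>\<A>. \<forall>e2\<in>\<A>. e1 \<noteq> e2 \<longrightarrow> e1 \<inter> e2 = {})"

definition piecewise_C2 :: "(real \<Rightarrow> pt) \<Rightarrow> bool" where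
  "piecewise_C2 g \<longleftrightarrow> continuous_on {0..1} g \<and>
     (\<exists>S. finite S \<and> {0,1} \<subseteq> S \<and> S \<subseteq> {0..1} \<and>
        (\<forall>a\<in>S. \<forall>b\<in>S. a < b \<and> {a<..<b} \<inter> S = {} \<longrightarrow>
           (\<exists>h h' h''. (\<forall>t\<in>{a..b}. h t = g t) \<and>
              (\<forall>t. (h has_vector_derivative h' t) (at t)) \<and>
              (\<forall>t. (h' has_vector_derivative h'' t) (at t)) \<and>
              continuous_on UNIV h'')))"

definition curve_length :: "(real \<Rightarrow> pt) \<Rightarrow> real" where
  "curve_length g = integral {0..1} (\<lambda>t. norm (vector_derivative g (at t)))"

definition admissible_curve :: "pt set \<Rightarrow> pt \<Rightarrow> pt \<Rightarrow> (real \<Rightarrow> pt) \<Rightarrow> bool" where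
  "admissible_curve X A B g \<longleftrightarrow> piecewise_C2 g \<and> g 0 = A \<and> g 1 = B \<and> path_image g \<subseteq> X"

definition shortest_curve :: "pt set \<Rightarrow> pt \<Rightarrow> pt \<Rightarrow> (real \<Rightarrow> pt) \<Rightarrow> bool" where
  "shortest_curve X A B g \<longleftrightarrow> admissible_curve X A B g \<and>
     (\<forall>g'. admissible_curve X A B g' \<longrightarrow> curve_length g \<le> curve_length g')"

definition line_segment_set :: "pt set \<Rightarrow> bool" where
  "line_segment_set S \<longleftrightarrow> (\<exists>a b. a \<noteq> b \<and> open_segment a b \<subseteq> S \<and> S \<subseteq> closed_segment a b)"

definition geodesic_segment :: "pt set set \<Rightarrow> pt set \<Rightarrow> bool" where
  "geodesic_segment \<A> S \<longleftrightarrow> line_segment_set S \<or>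
     (\<exists>c\<in>\<A>. one_cell c \<and> S \<subseteq> c \<and> connected S \<and> \<not> (\<exists>p. S \<subseteq> {p}))"

definition finiteness_property :: "pt set set \<Rightarrow> pt set \<Rightarrow> bool" where
  "finiteness_property \<A> X \<longleftrightarrow>
     (\<forall>A\<in>X. \<forall>B\<in>X. \<forall>g. shortest_curve X A B g \<longrightarrow>
        (\<forall>e\<in>\<A>. path_image g \<inter> e = {} \<or>
           (finite (components (path_image g \<inter> e)) \<and>
            (\<forall>C\<in>components (path_image g \<inter> e). (\<exists>p. C = {p}) \<or> geodesic_segment \<A> C))))"

end

theory Submission
  imports Defs "HOL-Computational_Algebra.Polynomial_Factorial" "HOL-Computational_Algebra.Field_as_Ring"
begin

text \<open>Decompositions may be countable, which is exploited throughout: all cells are pieces of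
  dyadic squares, so only the local structure of \<open>X\<close> matters. Let \<open>Z\<close> be the union of the zero
  sets of the nonzero polynomials describing \<open>X\<close>. Off \<open>Z\<close> the set \<open>X\<close> is open and is cut into
  convex cells; a shortest curve meets a convex subset of \<open>X\<close> in a convex set. Away from finitely
  many points (common zeros of a prime factor \<open>P\<close> and a polynomial not divisible by \<open>P\<close>), \<open>Z\<close> is
  locally a vertical line or the graph of a monotone function that is convex or concave, it lies in
  \<open>X\<close> if it meets \<open>X\<close>, and each side of the graph lies in \<open>X\<close> or is disjoint from \<open>X\<close>. If the
  side above a convex graph lies in \<open>X\<close>, chords are available and a shortest curve meets the
  graph in at most two points or in a segment. Otherwise a shortest curve cannot leave the graph
  and return to it within a small box, because the height below the graph would have an interior
  maximum along a straight piece of the curve; by uniform continuity only finitely many longer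
  excursions occur.\<close>

section \<open>Shortest curves\<close>

text \<open>The danger is that one cell is met infinitely often, for instance by excursions from an
  arc that accumulate at an end point of the arc. Cells may pile up along the zero set and at
  exceptional points; this is harmless, as every cell is examined alone. Prime factors are used
  because on the zero set of a multiple factor the y-derivative vanishes identically, while a prime
  of positive degree in y cannot divide its own y-derivative. Monotonicity makes the part of a graph
  in a box a single point or a single arc, hence a cell; convexity controls the curve. Both follow
  from constant signs of polynomials along the zero set, as the first two derivatives of an implicit
  function are rational in partial derivatives of the polynomial.\<close>

definition C2_piece :: "(real \<Rightarrow> pt) \<Rightarrow> real \<Rightarrow> real \<Rightarrow> bool" where
  "C2_piece g a b \<longleftrightarrow> (\<exists>h h' h''. (\<forall>t\<in>{a..b}. h t = g t) \<and>
     (\<forall>t. (h has_vector_derivative h' t) (at t)) \<and>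
     (\<forall>t. (h' has_vector_derivative h'' t) (at t)) \<and>
     continuous_on UNIV h'')"

text \<open>Every interval avoiding \<open>S\<close> counts here, not only one between neighbouring
  breakpoints, and \<open>S\<close> need not lie in the unit interval. So breakpoints may be added
  freely, as happens when a chord is inserted.\<close>

definition C2_off :: "real set \<Rightarrow> (real \<Rightarrow> pt) \<Rightarrow> bool" where
  "C2_off S g \<longleftrightarrow>
     (\<forall>a b. 0 \<le> a \<and> a < b \<and> b \<le> 1 \<and> {a<..<b} \<inter> S = {} \<longrightarrow> C2_piece g a b)"

lemma C2_piece_cong:
  assumes "C2_piece g a b" and "\<And>t. t \<in> {c..d} \<Longrightarrow> g' t = g t" and "{c..d} \<subseteq> {a..b}"
  shows "C2_piece g' c d"
  using assms unfolding C2_piece_def by (metis subsetD)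

lemma C2_piece_affine: "C2_piece (\<lambda>t. p + (t - s) *\<^sub>R q) a b"
proof -
  have "((\<lambda>t. p + (t - s) *\<^sub>R q) has_vector_derivative q) (at t)" for t
    by (auto intro!: derivative_eq_intros)
  moreover have "((\<lambda>t. q) has_vector_derivative 0) (at t)" for t
    by auto
  ultimately show ?thesis
    unfolding C2_piece_def by (metis continuous_on_const)
qed

text \<open>An interval whose interior avoids the breakpoints lies between the last breakpoint
  before it and the first one after it, and a C2 extension serves all subintervals. Conversely
  \<open>S\<close> is cut down to the unit interval and 0 and 1 are added.\<close>

lemma piecewise_C2_iff:
  "piecewise_C2 g \<longleftrightarrow> continuous_on {0..1} g \<and> (\<exists>S. finite S \<and> C2_off S g)"
proof
  assume pw: "piecewise_C2 g"
  then obtain S where S: "finite S" "{0,1} \<subseteq> S" "S \<subseteq> {0..1}"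
    and pieces: "\<And>a b. a \<in> S \<Longrightarrow> b \<in> S \<Longrightarrow> a < b \<Longrightarrow> {a<..<b} \<inter> S = {} \<Longrightarrow> C2_piece g a b"
    unfolding piecewise_C2_def C2_piece_def by metis
  have "C2_piece g a b" if ab: "0 \<le> a" "a < b" "b \<le> 1" "{a<..<b} \<inter> S = {}" for a b
  proof -
    define A where "A = {s \<in> S. s \<le> a}"
    define B where "B = {s \<in> S. b \<le> s}"
    have fin: "finite A" "finite B" and ne: "A \<noteq> {}" "B \<noteq> {}"
      using S ab by (auto simp: A_def B_def)
    have m: "Max A \<in> A" "Min B \<in> B" using fin ne by auto
    have "{Max A<..<Min B} \<inter> S = {}"
    proof -
      have False if "x \<in> S" "Max A < x" "x < Min B" for x
      proof -
        have "x \<notin> A" "x \<notin> B" using that fin by (meson Max_ge Min_le not_le)+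
        then have "x \<in> {a<..<b}" using that by (auto simp: A_def B_def)
        with ab that show False by blast
      qed
      then show ?thesis by auto
    qed
    moreover have "Max A \<in> S" "Min B \<in> S" "Max A \<le> a" "b \<le> Min B"
      using m by (auto simp: A_def B_def)
    ultimately have "C2_piece g (Max A) (Min B)" using pieces ab by auto
    then show ?thesis
      by (rule C2_piece_cong) (use \<open>Max A \<le> a\<close> \<open>b \<le> Min B\<close> in auto)
  qed
  then show "continuous_on {0..1} g \<and> (\<exists>S. finite S \<and> C2_off S g)"
    using pw S unfolding piecewise_C2_def C2_off_def by metis
next
  assume "continuous_on {0..1} g \<and> (\<exists>S. finite S \<and> C2_off S g)"
  then obtain S where c: "continuous_on {0..1} g" and S: "finite S" "C2_off S g" by blast
  define T where "T = (S \<inter> {0..1}) \<union> {0,1}"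
  have "C2_piece g a b" if ab: "a \<in> T" "b \<in> T" "a < b" "{a<..<b} \<inter> T = {}" for a b
  proof -
    have "0 \<le> a" "b \<le> 1" using ab by (auto simp: T_def)
    moreover have "{a<..<b} \<inter> S = {}"
      using ab \<open>0 \<le> a\<close> \<open>b \<le> 1\<close> by (force simp: T_def)
    ultimately show ?thesis using S ab by (auto simp: C2_off_def)
  qed
  moreover have "finite T" "{0,1} \<subseteq> T" "T \<subseteq> {0..1}" using S by (auto simp: T_def)
  ultimately show "piecewise_C2 g"
    using c unfolding piecewise_C2_def C2_piece_def by meson
qed

lemma C2_piece_vector_derivative:
  assumes "C2_piece g a b"
  obtains h' where "continuous_on {a..b} h'"
    and "\<And>t. t \<in> {a<..<b} \<Longrightarrow> (g has_vector_derivative h' t) (at t)"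
proof -
  obtain h h' h'' where h: "\<forall>t\<in>{a..b}. h t = g t"
     "\<forall>t. (h has_vector_derivative h' t) (at t)"
     "\<forall>t. (h' has_vector_derivative h'' t) (at t)"
    using assms unfolding C2_piece_def by blast
  have "continuous_on {a..b} h'"
    using h(3) by (meson continuous_at_imp_continuous_on has_vector_derivative_continuous)
  moreover have "(g has_vector_derivative h' t) (at t)" if "t \<in> {a<..<b}" for t
    using has_vector_derivative_transform_within_open[of h "h' t" t "{a<..<b}" g] h that by auto
  ultimately show thesis using that by blast
qed

text \<open>Induction on the number of breakpoints inside the interval; with none, the speed agrees
  off the end points with a continuous function. Since \<open>integral\<close> is 0 for a function
  that is not integrable, lengths can be compared only after this is known.\<close>

lemma C2_off_integrable_speed:
  assumes "C2_off S g" "finite S"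
  shows "0 \<le> a \<Longrightarrow> a \<le> b \<Longrightarrow> b \<le> 1 \<Longrightarrow>
    (\<lambda>t. norm (vector_derivative g (at t))) integrable_on {a..b}"
proof (induction "card (S \<inter> {a<..<b})" arbitrary: a b rule: less_induct)
  case less
  show ?case
  proof (cases "S \<inter> {a<..<b} = {}")
    case True
    show ?thesis
    proof (cases "a = b")
      case False
      then have "C2_piece g a b" using less.prems True assms by (auto simp: C2_off_def Int_commute)
      then obtain h' where h': "continuous_on {a..b} h'"
        "\<And>t. t \<in> {a<..<b} \<Longrightarrow> (g has_vector_derivative h' t) (at t)"
        by (rule C2_piece_vector_derivative) blast
      have "(\<lambda>t. norm (h' t)) integrable_on {a..b}"
        by (intro integrable_continuous_real continuous_intros h')
      then show ?thesis
      proof (rule integrable_spike_finite[of "{a,b}", rotated -1])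
        fix x assume "x \<in> {a..b} - {a,b}"
        then have "x \<in> {a<..<b}" by auto
        then show "norm (vector_derivative g (at x)) = norm (h' x)"
          using h'(2)[THEN vector_derivative_at] by simp
      qed auto
    qed (use has_integral_refl in \<open>auto simp: integrable_on_def\<close>)
  next
    case False
    then obtain c where c: "c \<in> S" "a < c" "c < b" by auto
    have "card (S \<inter> {a<..<c}) < card (S \<inter> {a<..<b})" "card (S \<inter> {c<..<b}) < card (S \<inter> {a<..<b})"
      using c assms(2) by (auto intro!: psubset_card_mono)
    then have "(\<lambda>t. norm (vector_derivative g (at t))) integrable_on {a..c}"
      "(\<lambda>t. norm (vector_derivative g (at t))) integrable_on {c..b}"
      using less.hyps less.prems c by auto
    then show ?thesis
      using c by (intro Henstock_Kurzweil_Integration.integrable_combine[of a c b]) auto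
  qed
qed

lemma piecewise_C2_integrable_speed:
  assumes "piecewise_C2 g" "0 \<le> a" "b \<le> 1"
  shows "(\<lambda>t. norm (vector_derivative g (at t))) integrable_on {a..b}"
proof (cases "a \<le> b")
  case True
  then show ?thesis using assms C2_off_integrable_speed unfolding piecewise_C2_iff by blast
qed auto

text \<open>Off the finitely many breakpoints the curve is differentiable, which suffices for the
  fundamental theorem of calculus; the norm of the integral is then bounded by the integral of the
  norm.\<close>

lemma piecewise_C2_dist_le:
  assumes "piecewise_C2 g" "0 \<le> a" "a \<le> b" "b \<le> 1"
  shows "dist (g a) (g b) \<le> integral {a..b} (\<lambda>t. norm (vector_derivative g (at t)))"
proof -
  obtain S where c: "continuous_on {0..1} g" and S: "finite S" "C2_off S g"
    using assms unfolding piecewise_C2_iff by blast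
  have "(g has_vector_derivative vector_derivative g (at t)) (at t)" if t: "t \<in> {a<..<b} - S" for t
  proof -
    have "open ({a<..<b} - S)" using S by (intro open_Diff finite_imp_closed) auto
    then obtain e where e: "e > 0" "cball t e \<subseteq> {a<..<b} - S"
      using t open_contains_cball by meson
    have *: "{t - e..t + e} \<subseteq> {a<..<b} - S" using e by (simp add: cball_eq_atLeastAtMost)
    have "t - e \<in> {a<..<b}" "t + e \<in> {a<..<b}"
      using subsetD[OF *, of "t - e"] subsetD[OF *, of "t + e"] e by auto
    moreover have "{t - e<..<t + e} \<inter> S = {}" using * greaterThanLessThan_subseteq_atLeastAtMost_iff by fastforce
    ultimately have "C2_piece g (t - e) (t + e)"
      using S e assms by (auto simp: C2_off_def)
    then obtain h' where "\<And>u. u \<in> {t - e<..<t + e} \<Longrightarrow> (g has_vector_derivative h' u) (at u)"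
      by (rule C2_piece_vector_derivative) blast
    then have "(g has_vector_derivative h' t) (at t)" using e by auto
    then show ?thesis by (metis vector_derivative_at)
  qed
  then have I: "((\<lambda>t. vector_derivative g (at t)) has_integral (g b - g a)) {a..b}"
    using S assms c
    by (intro fundamental_theorem_of_calculus_interior_strong[of S])
       (auto intro: continuous_on_subset)
  then have "norm (integral {a..b} (\<lambda>t. vector_derivative g (at t)))
      \<le> integral {a..b} (\<lambda>t. norm (vector_derivative g (at t)))"
    using piecewise_C2_integrable_speed[OF assms(1,2,4)]
    by (intro integral_norm_bound_integral) (auto simp: has_integral_integrable)
  then show ?thesis
    using I by (simp add: integral_unique dist_norm norm_minus_commute)
qed

text \<open>The arc over \<open>{s..t}\<close> is replaced by its chord, run at constant velocity.
  The parameter interval is kept, so the result competes with \<open>g\<close> without any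
  reparametrization.\<close>

definition straighten :: "real \<Rightarrow> real \<Rightarrow> (real \<Rightarrow> pt) \<Rightarrow> real \<Rightarrow> pt" where
  "straighten s t g u = (if u \<in> {s..t} then g s + (u - s) *\<^sub>R ((g t - g s) /\<^sub>R (t - s)) else g u)"

lemma straighten_eq:
  assumes "u \<notin> {s<..<t}" "s < t"
  shows "straighten s t g u = g u"
proof -
  have "u = s \<or> u = t \<or> u \<notin> {s..t}" using assms by auto
  then show ?thesis using assms(2) by (auto simp: straighten_def)
qed

lemma straighten_in_segment:
  assumes "u \<in> {s..t}" "s < t"
  shows "straighten s t g u \<in> closed_segment (g s) (g t)"
  unfolding in_segment
proof (intro exI conjI)
  show "0 \<le> (u - s) / (t - s)" "(u - s) / (t - s) \<le> 1" using assms by auto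
  show "straighten s t g u = (1 - (u - s) / (t - s)) *\<^sub>R g s + ((u - s) / (t - s)) *\<^sub>R g t"
    using assms by (simp add: straighten_def algebra_simps divide_inverse)
qed

lemma piecewise_C2_straighten:
  assumes "piecewise_C2 g" "0 \<le> s" "s < t" "t \<le> 1"
  shows "piecewise_C2 (straighten s t g)"
proof -
  obtain S where c: "continuous_on {0..1} g" and S: "finite S" "C2_off S g"
    using assms unfolding piecewise_C2_iff by blast
  have "continuous_on ({0..s} \<union> {s..t} \<union> {t..1}) (straighten s t g)"
  proof (intro continuous_on_closed_Un)
    show "continuous_on {0..s} (straighten s t g)" "continuous_on {t..1} (straighten s t g)"
      using assms
      by (auto intro!: continuous_on_eq[OF continuous_on_subset[OF c]] simp: straighten_eq)
    show "continuous_on {s..t} (straighten s t g)"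
      unfolding straighten_def
      by (rule continuous_on_eq[of _ "\<lambda>u. g s + (u - s) *\<^sub>R ((g t - g s) /\<^sub>R (t - s))"])
         (auto intro!: continuous_intros)
  qed auto
  moreover have "{0..s} \<union> {s..t} \<union> {t..1} = {0..1}" using assms by auto
  ultimately have "continuous_on {0..1} (straighten s t g)" by simp
  moreover have "C2_off (S \<union> {s,t}) (straighten s t g)"
    unfolding C2_off_def
  proof (intro allI impI)
    fix a b :: real
    assume ab: "0 \<le> a \<and> a < b \<and> b \<le> 1 \<and> {a<..<b} \<inter> (S \<union> {s,t}) = {}"
    then have st: "s \<notin> {a<..<b}" "t \<notin> {a<..<b}" by auto
    show "C2_piece (straighten s t g) a b"
    proof (cases "s \<le> a \<and> b \<le> t")
      case True
      show ?thesis
        by (rule C2_piece_cong[OF C2_piece_affine[of "g s" s "(g t - g s) /\<^sub>R (t - s)" a b]])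
           (use True in \<open>auto simp: straighten_def\<close>)
    next
      case False
      have "C2_piece g a b" using ab S by (auto simp: C2_off_def)
      then show ?thesis
      proof (rule C2_piece_cong)
        show "straighten s t g u = g u" if "u \<in> {a..b}" for u
          using False st that ab assms by (intro straighten_eq) auto
      qed auto
    qed
  qed
  ultimately show ?thesis
    using S unfolding piecewise_C2_iff by (intro conjI exI[of _ "S \<union> {s,t}"]) simp_all
qed

lemma admissible_curve_straighten:
  assumes "admissible_curve X A B g" "0 \<le> s" "s < t" "t \<le> 1" "closed_segment (g s) (g t) \<subseteq> X"
  shows "admissible_curve X A B (straighten s t g)"
proof -
  have "straighten s t g u \<in> X" if "u \<in> {0..1}" for u
  proof (cases "u \<in> {s..t}")
    case True
    then show ?thesis using straighten_in_segment assms by blast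
  next
    case False
    then show ?thesis using assms that by (auto simp: straighten_def admissible_curve_def path_image_def)
  qed
  moreover have "straighten s t g 0 = g 0" "straighten s t g 1 = g 1"
    using assms by (auto intro!: straighten_eq)
  moreover have "piecewise_C2 (straighten s t g)"
    using assms by (intro piecewise_C2_straighten) (auto simp: admissible_curve_def)
  ultimately show ?thesis
    using assms(1) by (simp add: admissible_curve_def path_image_def image_subset_iff)
qed

lemma curve_length_split:
  assumes "piecewise_C2 g" "0 \<le> s" "s \<le> t" "t \<le> 1"
  shows "curve_length g = integral {0..s} (\<lambda>t. norm (vector_derivative g (at t)))
    + integral {s..t} (\<lambda>t. norm (vector_derivative g (at t)))
    + integral {t..1} (\<lambda>t. norm (vector_derivative g (at t)))"
  unfolding curve_length_def
  using Henstock_Kurzweil_Integration.integral_combine[OF _ _ piecewise_C2_integrable_speed[OF assms(1)], of 0 s 1]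
    Henstock_Kurzweil_Integration.integral_combine[OF _ _ piecewise_C2_integrable_speed[OF assms(1)], of s t 1] assms
  by simp

text \<open>The derivative at an interior point depends only on nearby values; at the two end points
  it may differ, and these form a null set.\<close>

lemma integral_speed_eq:
  assumes "\<And>u. u \<in> {a<..<b} \<Longrightarrow> g u = g' u"
  shows "integral {a..b} (\<lambda>t. norm (vector_derivative g (at t)))
    = integral {a..b} (\<lambda>t. norm (vector_derivative g' (at t)))"
proof (rule integral_spike[of "{a,b}"])
  fix x assume "x \<in> {a..b} - {a,b}"
  then have x: "x \<in> {a<..<b}" by auto
  have "eventually (\<lambda>y. y \<in> {a<..<b}) (nhds x)" using x by (intro eventually_nhds_in_open) auto
  then have "eventually (\<lambda>y. y \<in> UNIV \<longrightarrow> g' y = g y) (nhds x)"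
    by eventually_elim (use assms in auto)
  then have "vector_derivative g' (at x) = vector_derivative g (at x)"
    using assms[OF x] by (intro vector_derivative_cong_eq) auto
  then show "norm (vector_derivative g' (at x)) = norm (vector_derivative g (at x))" by simp
qed auto

lemma curve_length_straighten:
  assumes "piecewise_C2 g" "0 \<le> s" "s < t" "t \<le> 1"
  shows "curve_length (straighten s t g) = integral {0..s} (\<lambda>t. norm (vector_derivative g (at t)))
    + dist (g s) (g t) + integral {t..1} (\<lambda>t. norm (vector_derivative g (at t)))"
proof -
  let ?q = "(g t - g s) /\<^sub>R (t - s)"
  have "integral {s..t} (\<lambda>u. norm (vector_derivative (straighten s t g) (at u)))
     = integral {s..t} (\<lambda>u. norm (vector_derivative (\<lambda>u. g s + (u - s) *\<^sub>R ?q) (at u)))"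
    by (rule integral_speed_eq) (auto simp: straighten_def)
  also have "(\<lambda>u. vector_derivative (\<lambda>u. g s + (u - s) *\<^sub>R ?q) (at u)) = (\<lambda>u. ?q)"
    by (intro ext vector_derivative_at) (auto intro!: derivative_eq_intros)
  also have "integral {s..t} (\<lambda>u. norm ?q) = dist (g s) (g t)"
    using assms by (simp add: dist_norm norm_minus_commute)
  finally have 1: "integral {s..t} (\<lambda>u. norm (vector_derivative (straighten s t g) (at u))) = dist (g s) (g t)" .
  have 2: "integral {0..s} (\<lambda>u. norm (vector_derivative (straighten s t g) (at u)))
      = integral {0..s} (\<lambda>u. norm (vector_derivative g (at u)))"
    by (rule integral_speed_eq) (auto simp: straighten_def)
  have 3: "integral {t..1} (\<lambda>u. norm (vector_derivative (straighten s t g) (at u)))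
      = integral {t..1} (\<lambda>u. norm (vector_derivative g (at u)))"
    by (rule integral_speed_eq) (auto simp: straighten_def)
  show ?thesis
    using curve_length_split[OF piecewise_C2_straighten[OF assms], of s t] assms 1 2 3 by simp
qed

lemma shortest_curve_continuous: "shortest_curve X A B g \<Longrightarrow> continuous_on {0..1} g"
  by (auto simp: shortest_curve_def admissible_curve_def piecewise_C2_def)

lemma shortest_curve_mem: "shortest_curve X A B g \<Longrightarrow> t \<in> {0..1} \<Longrightarrow> g t \<in> X"
  by (auto simp: shortest_curve_def admissible_curve_def path_image_def)

text \<open>Equality in the triangle inequality puts each \<open>g r\<close> on the segment. A
  connected collinear set that contains both ends fills the segment.\<close>

lemma image_between_imp_segment:
  fixes g :: "real \<Rightarrow> pt"
  assumes "continuous_on {s..t} g" "s \<le> t"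
    and le: "\<And>r. r \<in> {s..t} \<Longrightarrow> dist (g s) (g r) + dist (g r) (g t) \<le> dist (g s) (g t)"
  shows "g ` {s..t} = closed_segment (g s) (g t)"
proof
  have "between (g s, g t) (g r)" if "r \<in> {s..t}" for r
    using le[OF that] dist_triangle[of "g s" "g t" "g r"] by (simp add: between)
  then show sub: "g ` {s..t} \<subseteq> closed_segment (g s) (g t)"
    by (auto simp: between_mem_segment)
  have "connected (g ` {s..t})" using assms by (intro connected_continuous_image) auto
  moreover have "g s \<in> g ` {s..t}" "g t \<in> g ` {s..t}" using assms by auto
  moreover have "collinear (g ` {s..t})"
    using sub collinear_closed_segment collinear_subset by blast
  ultimately show "closed_segment (g s) (g t) \<subseteq> g ` {s..t}"
    by (meson closed_segment_subset convex_connected_collinear)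
qed

text \<open>Minimality enters the whole proof through this lemma: inserting the chord gives no
  shorter curve, so the arc is no longer than the chord, and then every intermediate point attains
  equality in the triangle inequality.\<close>

lemma shortest_curve_segment:
  assumes g: "shortest_curve X A B g" and st: "0 \<le> s" "s \<le> t" "t \<le> 1"
    and seg: "closed_segment (g s) (g t) \<subseteq> X"
  shows "g ` {s..t} = closed_segment (g s) (g t)"
proof (cases "s = t")
  case False
  with st have "s < t" by simp
  have adm: "admissible_curve X A B g" and pw: "piecewise_C2 g"
    using g by (auto simp: shortest_curve_def admissible_curve_def)
  have "curve_length g \<le> curve_length (straighten s t g)"
    using g admissible_curve_straighten[OF adm st(1) \<open>s < t\<close> st(3) seg] by (auto simp: shortest_curve_def)
  then have len: "integral {s..t} (\<lambda>t. norm (vector_derivative g (at t))) \<le> dist (g s) (g t)"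
    unfolding curve_length_straighten[OF pw st(1) \<open>s < t\<close> st(3)] curve_length_split[OF pw st] by simp
  show ?thesis
  proof (rule image_between_imp_segment)
    show "continuous_on {s..t} g"
      using shortest_curve_continuous[OF g] by (rule continuous_on_subset) (use st in auto)
    fix r assume r: "r \<in> {s..t}"
    have "dist (g s) (g r) \<le> integral {s..r} (\<lambda>t. norm (vector_derivative g (at t)))"
         "dist (g r) (g t) \<le> integral {r..t} (\<lambda>t. norm (vector_derivative g (at t)))"
      using piecewise_C2_dist_le[OF pw] r st by auto
    moreover have "integral {s..r} (\<lambda>t. norm (vector_derivative g (at t)))
       + integral {r..t} (\<lambda>t. norm (vector_derivative g (at t)))
       = integral {s..t} (\<lambda>t. norm (vector_derivative g (at t)))"
      using r st piecewise_C2_integrable_speed[OF pw]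
      by (intro Henstock_Kurzweil_Integration.integral_combine) auto
    ultimately show "dist (g s) (g r) + dist (g r) (g t) \<le> dist (g s) (g t)" using len by linarith
  qed fact
qed auto

section \<open>Intersections of shortest curves with cells\<close>

text \<open>A component contains a point of some \<open>C\<close> in \<open>F\<close>, hence all of
  the connected set \<open>C\<close> and in particular its chosen point. So components are indexed
  by members of \<open>F\<close>.\<close>

lemma finite_components_Union:
  assumes "finite F" "\<And>C. C \<in> F \<Longrightarrow> connected C"
  shows "finite (components (\<Union>F))"
proof (rule finite_subset)
  show "components (\<Union>F) \<subseteq> (\<lambda>C. connected_component_set (\<Union>F) (SOME x. x \<in> C)) ` F"
  proof
    fix D assume "D \<in> components (\<Union>F)"
    then obtain x where x: "x \<in> \<Union>F" "D = connected_component_set (\<Union>F) x"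
      by (auto simp: components_def)
    then obtain C where C: "C \<in> F" "x \<in> C" by blast
    define y where "y = (SOME x. x \<in> C)"
    have "y \<in> C" unfolding y_def using C by (metis someI)
    then have "connected_component (\<Union>F) x y"
      using C assms(2)[OF C(1)] unfolding connected_component_def by blast
    then have "D = connected_component_set (\<Union>F) y"
      using x by (metis connected_component_eq mem_Collect_eq)
    then show "D \<in> (\<lambda>C. connected_component_set (\<Union>F) (SOME x. x \<in> C)) ` F"
      using C by (auto simp: y_def)
  qed
qed (use assms in auto)

text \<open>The finiteness property for one cell, without reference to a decomposition. Every
  nondegenerate connected subset of a 1-cell is a geodesic segment, so for a 1-cell only the number
  of components is at stake.\<close>

definition tame_cell :: "pt set \<Rightarrow> pt set \<Rightarrow> bool" where
  "tame_cell X e \<longleftrightarrow> (\<forall>A B g. shortest_curve X A B g \<longrightarrow>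
     finite (components (path_image g \<inter> e)) \<and>
     (\<forall>C\<in>components (path_image g \<inter> e). (\<exists>p. C = {p}) \<or> line_segment_set C \<or> one_cell e))"

lemma tame_one_cell:
  assumes "one_cell e"
    and "\<And>A B g. shortest_curve X A B g \<Longrightarrow> finite (components (path_image g \<inter> e))"
  shows "tame_cell X e"
  using assms unfolding tame_cell_def by blast

text \<open>Of three points of \<open>C\<close>, take those visited first and last: their chord lies
  in \<open>C\<close>, hence in \<open>X\<close>, so the curve runs along it and the third point is
  on it. Thus \<open>C\<close> is collinear, its closure is a segment, and a convex set contains the
  relative interior of its closure.\<close>

lemma shortest_curve_convex_piece:
  assumes g: "shortest_curve X A B g" and C: "C \<subseteq> path_image g" "convex C" "C \<noteq> {}"
  shows "(\<exists>p. C = {p}) \<or> line_segment_set C"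
proof -
  have CX: "C \<subseteq> X" using g C by (auto simp: shortest_curve_def admissible_curve_def)
  have tri: "collinear {x,y,z}" if xyz: "x \<in> C" "y \<in> C" "z \<in> C" for x y z
  proof -
    have "\<exists>r\<in>{0..1}. w = g r" if "w \<in> C" for w using that C(1) by (auto simp: path_image_def)
    then obtain r1 r2 r3 where r: "x = g r1" "y = g r2" "z = g r3" "{r1,r2,r3} \<subseteq> {0..1}"
      using xyz by (metis empty_subsetI insert_subset)
    define lo hi where "lo = min r1 (min r2 r3)" and "hi = max r1 (max r2 r3)"
    have "g lo \<in> C" "g hi \<in> C" using r xyz by (auto simp: lo_def hi_def min_def max_def)
    then have "closed_segment (g lo) (g hi) \<subseteq> X" using C(2) CX closed_segment_subset by blast
    moreover have "0 \<le> lo" "lo \<le> hi" "hi \<le> 1" using r by (auto simp: lo_def hi_def)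
    ultimately have "g ` {lo..hi} = closed_segment (g lo) (g hi)"
      using shortest_curve_segment[OF g] by blast
    moreover have "r1 \<in> {lo..hi}" "r2 \<in> {lo..hi}" "r3 \<in> {lo..hi}" by (auto simp: lo_def hi_def)
    ultimately have "{x,y,z} \<subseteq> closed_segment (g lo) (g hi)" using r by blast
    then show ?thesis using collinear_closed_segment collinear_subset by blast
  qed
  have "collinear C"
  proof (cases "\<exists>a b. a \<in> C \<and> b \<in> C \<and> a \<noteq> b")
    case True
    then obtain a b where ab: "a \<in> C" "b \<in> C" "a \<noteq> b" by blast
    then have "collinear (insert a (insert b C))" using collinear_triples tri by metis
    moreover have "insert a (insert b C) = C" using ab by auto
    ultimately show ?thesis by simp
  next
    case False
    with C(3) obtain p where "C = {p}" by blast
    then show ?thesis by simp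
  qed
  have "compact (path_image g)"
    using shortest_curve_continuous[OF g] unfolding path_image_def
    by (intro compact_continuous_image) auto
  then have "bounded C" using C(1) bounded_subset compact_imp_bounded by blast
  then have "compact (closure C)" "convex (closure C)" "collinear (closure C)" "closure C \<noteq> {}"
    using C \<open>collinear C\<close> by (auto simp: convex_closure collinear_aff_dim)
  then obtain a b where ab: "closure C = closed_segment a b"
    using compact_convex_collinear_segment by metis
  show ?thesis
  proof (cases "a = b")
    case True
    then have "C \<subseteq> {a}" using ab closure_subset by auto
    then show ?thesis using C by blast
  next
    case False
    have "open_segment a b = rel_interior (closure C)" using ab False by (simp add: rel_interior_closed_segment)
    also have "\<dots> \<subseteq> C" using C by (simp add: convex_rel_interior_closure rel_interior_subset)
    finally show ?thesis
      using ab False closure_subset unfolding line_segment_set_def by blast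
  qed
qed

lemma finite_components_convex: "convex C \<Longrightarrow> finite (components (C :: pt set))"
  using finite_components_Union[of "{C}"] by (simp add: convex_connected)

text \<open>The chord between two visited points of \<open>e\<close> lies in \<open>e\<close>, so
  the curve covers it. The intersection is therefore convex and has at most one component.\<close>

lemma tame_convex:
  assumes "convex e" "e \<subseteq> X"
  shows "tame_cell X e"
  unfolding tame_cell_def
proof (intro allI impI)
  fix A B g assume g: "shortest_curve X A B g"
  have *: "closed_segment (g s) (g t) \<subseteq> path_image g \<inter> e"
    if st: "s \<le> t" "s \<in> {0..1}" "t \<in> {0..1}" "g s \<in> e" "g t \<in> e" for s t
  proof -
    have "closed_segment (g s) (g t) \<subseteq> e" using st assms closed_segment_subset by blast
    moreover from this have "g ` {s..t} = closed_segment (g s) (g t)"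
      using shortest_curve_segment[OF g] st assms by auto
    moreover have "g ` {s..t} \<subseteq> path_image g" using st by (auto simp: path_image_def)
    ultimately show ?thesis by auto
  qed
  have "closed_segment x y \<subseteq> path_image g \<inter> e" if xy: "x \<in> path_image g \<inter> e" "y \<in> path_image g \<inter> e" for x y
  proof -
    obtain s t where "x = g s" "y = g t" "s \<in> {0..1}" "t \<in> {0..1}" using xy by (auto simp: path_image_def)
    then show ?thesis
      using *[of s t] *[of t s] xy by (cases "s \<le> t") (auto simp: closed_segment_commute)
  qed
  then have conv: "convex (path_image g \<inter> e)" unfolding convex_contains_segment by blast
  show "finite (components (path_image g \<inter> e)) \<and>
      (\<forall>C\<in>components (path_image g \<inter> e). (\<exists>p. C = {p}) \<or> line_segment_set C \<or> one_cell e)"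
  proof (intro conjI ballI)
    fix C assume C: "C \<in> components (path_image g \<inter> e)"
    then have "C = path_image g \<inter> e" "C \<noteq> {}"
      using convex_connected[OF conv] in_components_nonempty[OF C]
      unfolding connected_eq_components_subset_sing by auto
    then show "(\<exists>p. C = {p}) \<or> line_segment_set C \<or> one_cell e"
      using shortest_curve_convex_piece[OF g, of C] conv by auto
  qed (use conv finite_components_convex in blast)
qed

text \<open>Convexity gives \<open>\<phi>\<close> \<le> 0 on the segment. A negative value at
  \<open>w\<close> would make \<open>\<phi>\<close> negative at \<open>z\<close> too, because
  \<open>z\<close> lies between \<open>w\<close> and one of the ends, at positive distance from that
  end.\<close>

lemma convex_on_zero_segment:
  fixes \<phi> :: "pt \<Rightarrow> real"
  assumes "convex_on U \<phi>" "x \<in> U" "y \<in> U" "\<phi> x = 0" "\<phi> y = 0"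
    and "z \<in> open_segment x y" "\<phi> z = 0" "w \<in> closed_segment x y"
  shows "\<phi> w = 0"
proof -
  have U: "convex U" using assms(1) by (rule convex_on_imp_convex)
  obtain m where m: "0 < m" "m < 1" "z = (1 - m) *\<^sub>R x + m *\<^sub>R y"
    using assms(6) by (auto simp: in_segment)
  obtain u where u: "0 \<le> u" "u \<le> 1" "w = (1 - u) *\<^sub>R x + u *\<^sub>R y"
    using assms(8) by (auto simp: in_segment)
  have wU: "w \<in> U" using assms U closed_segment_subset by blast
  have le: "\<phi> w \<le> 0" using convex_onD[OF assms(1), of u x y] assms u by simp
  consider "u = m" | "u < m" | "m < u" by linarith
  then show ?thesis
  proof cases
    case 1
    then show ?thesis using m u assms by simp
  next
    case 2
    \<comment> \<open>The position of \<open>z\<close> between \<open>w\<close> and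
      \<open>y\<close>, that is, \<open>z = (1 - l) *\<^sub>R w + l *\<^sub>R y\<close>. In the
      other case \<open>l = m / u\<close> locates \<open>z\<close> between \<open>x\<close> and
      \<open>w\<close>.\<close>
    define l where "l = (m - u) / (1 - u)"
    have l: "0 \<le> l" "l < 1" using 2 m by (auto simp: l_def field_simps)
    have e: "l * (1 - u) = m - u" using 2 m by (simp add: l_def)
    have e2: "(1 - l) * (1 - u) = 1 - m" "(1 - l) * u + l = m" using e by (simp_all add: algebra_simps)
    have "z = ((1 - l) * (1 - u)) *\<^sub>R x + ((1 - l) * u + l) *\<^sub>R y" by (simp only: e2 m)
    also have "\<dots> = (1 - l) *\<^sub>R w + l *\<^sub>R y" by (simp add: u algebra_simps)
    finally have "\<phi> z \<le> (1 - l) * \<phi> w + l * \<phi> y"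
      using convex_onD[OF assms(1), of l w y] l wU assms by simp
    then have "0 \<le> (1 - l) * \<phi> w" using assms by simp
    with l le show ?thesis by (simp add: zero_le_mult_iff)
  next
    case 3
    define l where "l = m / u"
    have l: "0 < l" "l \<le> 1" using 3 m by (auto simp: l_def field_simps)
    have e: "l * u = m" using 3 m by (simp add: l_def)
    have e2: "(1 - l) + l * (1 - u) = 1 - m" using e by (simp add: algebra_simps)
    have "z = ((1 - l) + l * (1 - u)) *\<^sub>R x + (l * u) *\<^sub>R y" by (simp only: e e2 m)
    also have "\<dots> = (1 - l) *\<^sub>R x + l *\<^sub>R w" by (simp add: u algebra_simps)
    finally have "\<phi> z \<le> (1 - l) * \<phi> x + l * \<phi> w"
      using convex_onD[OF assms(1), of l x w] l wU assms by simp
    then have "0 \<le> l * \<phi> w" using assms by simp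
    with l le show ?thesis by (simp add: zero_le_mult_iff)
  qed
qed

text \<open>Chords between points of \<open>e\<close> lie in the sublevel set and so in
  \<open>X\<close>: the curve follows the chord between any two visits to \<open>e\<close>. As soon
  as three distinct points are visited, \<open>\<phi>\<close> vanishes along the outer chord, which
  then belongs to \<open>e\<close>. So the intersection has at most two points or is convex.\<close>

lemma tame_sublevel_boundary:
  fixes \<phi> :: "pt \<Rightarrow> real"
  assumes one: "one_cell e" and \<phi>: "convex_on U \<phi>" and X: "{p \<in> U. \<phi> p \<le> 0} \<subseteq> X"
    and W: "convex W" "W \<subseteq> U" and e: "e = {p \<in> W. \<phi> p = 0}"
  shows "tame_cell X e"
proof (rule tame_one_cell[OF one])
  fix A B g assume g: "shortest_curve X A B g"
  let ?C = "path_image g \<inter> e"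
  have seg0: "closed_segment x y \<subseteq> X" if xy: "x \<in> e" "y \<in> e" for x y
  proof
    fix z assume z: "z \<in> closed_segment x y"
    then obtain u where u: "0 \<le> u" "u \<le> 1" "z = (1 - u) *\<^sub>R x + u *\<^sub>R y" by (auto simp: in_segment)
    then have "\<phi> z \<le> 0" using convex_onD[OF \<phi>, of u x y] xy W e by auto
    moreover have "z \<in> U" using xy W e closed_segment_subset z by blast
    ultimately show "z \<in> X" using X by blast
  qed
  have im: "g ` {s..t} = closed_segment (g s) (g t)"
    if "0 \<le> s" "s \<le> t" "t \<le> 1" "g s \<in> e" "g t \<in> e" for s t
    using that shortest_curve_segment[OF g] seg0 by blast
  \<comment> \<open>The middle visit \<open>g b\<close> is an interior zero of \<open>\<phi>\<close>
    on the chord from \<open>g a\<close> to \<open>g c\<close>. Arbitrary \<open>u\<close> and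
    \<open>v\<close> in \<open>{a..c}\<close> let this one fact serve all six orders of three
    visits.\<close>
  have tri: "closed_segment (g u) (g v) \<subseteq> ?C"
    if "0 \<le> a" "a < b" "b < c" "c \<le> 1" and "g a \<in> e" "g b \<in> e" "g c \<in> e"
      and "g b \<noteq> g a" "g b \<noteq> g c" and "u \<in> {a..c}" "v \<in> {a..c}" for a b c u v
  proof -
    have S: "g ` {a..c} = closed_segment (g a) (g c)" using that by (intro im) auto
    have "g b \<in> g ` {a..c}" using that by auto
    then have "g b \<in> open_segment (g a) (g c)" using S that by (auto simp: open_segment_def)
    then have "\<phi> w = 0" if "w \<in> closed_segment (g a) (g c)" for w
      using convex_on_zero_segment[OF \<phi>] that \<open>g a \<in> e\<close> \<open>g b \<in> e\<close> \<open>g c \<in> e\<close> e W by blast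
    moreover have "closed_segment (g a) (g c) \<subseteq> W"
      using W e \<open>g a \<in> e\<close> \<open>g c \<in> e\<close> closed_segment_subset by blast
    ultimately have "closed_segment (g a) (g c) \<subseteq> e" using e by blast
    moreover have "closed_segment (g a) (g c) \<subseteq> path_image g"
      unfolding S[symmetric] path_image_def using that by (intro image_mono) auto
    moreover have "g u \<in> closed_segment (g a) (g c)" "g v \<in> closed_segment (g a) (g c)"
      using that unfolding S[symmetric] by blast+
    ultimately show ?thesis using subset_closed_segment by blast
  qed
  show "finite (components ?C)"
  proof (cases "\<exists>x y. ?C \<subseteq> {x,y}")
    case True
    then have "finite ?C" using finite_subset by blast
    then have "finite (components (\<Union>((\<lambda>x. {x}) ` ?C)))" by (intro finite_components_Union) auto
    then show ?thesis by simp
  next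
    case False
    have "closed_segment x y \<subseteq> ?C" if xy: "x \<in> ?C" "y \<in> ?C" for x y
    proof (cases "x = y")
      case True
      then show ?thesis using xy by auto
    next
      case neq: False
      obtain z where z: "z \<in> ?C" "z \<noteq> x" "z \<noteq> y" using False by blast
      have "\<exists>r\<in>{0..1}. w = g r" if "w \<in> ?C" for w using that by (auto simp: path_image_def)
      then obtain p q r where r: "x = g p" "y = g q" "z = g r" "{p,q,r} \<subseteq> {0..1}"
        using xy z by (metis empty_subsetI insert_subset)
      have "p \<noteq> q" "p \<noteq> r" "q \<noteq> r" using r neq z by auto
      then consider "p < q" "q < r" | "p < r" "r < q" | "q < p" "p < r" | "q < r" "r < p"
        | "r < p" "p < q" | "r < q" "q < p" by linarith
      then show ?thesis
      proof cases
        case 1 then show ?thesis using tri[of p q r p q] r xy z neq by auto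
      next
        case 2 then show ?thesis using tri[of p r q p q] r xy z neq by auto
      next
        case 3 then show ?thesis using tri[of q p r p q] r xy z neq by auto
      next
        case 4 then show ?thesis using tri[of q r p p q] r xy z neq by auto
      next
        case 5 then show ?thesis using tri[of r p q p q] r xy z neq by auto
      next
        case 6 then show ?thesis using tri[of r q p p q] r xy z neq by auto
      qed
    qed
    then have "convex ?C" unfolding convex_contains_segment by blast
    then show ?thesis by (rule finite_components_convex)
  qed
qed

text \<open>A maximum principle. Once \<open>\<phi>\<close> is positive at a point of the curve,
  \<open>side\<close> puts the open region \<open>\<phi>\<close> > 0 into \<open>X\<close>, so the
  curve is straight near a point where \<open>\<phi>\<close> is maximal along it. A convex function
  on a segment cannot have an interior maximum with a strictly smaller value at one end.\<close>

lemma shortest_curve_stays_on_boundary: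
  fixes \<phi> :: "pt \<Rightarrow> real"
  assumes g: "shortest_curve X A B g" and U: "open U"
    and \<phi>: "convex_on U \<phi>" "continuous_on U \<phi>"
    and X: "\<And>p. p \<in> X \<Longrightarrow> p \<in> U \<Longrightarrow> \<phi> p \<ge> 0"
    and side: "{p \<in> U. \<phi> p > 0} \<subseteq> X \<or> {p \<in> U. \<phi> p > 0} \<inter> X = {}"
    and st: "0 \<le> s" "t \<le> 1" "g ` {s..t} \<subseteq> U" "\<phi> (g s) = 0" "\<phi> (g t) = 0"
    and r: "r \<in> {s..t}"
  shows "\<phi> (g r) = 0"
proof (rule ccontr)
  assume nz: "\<phi> (g r) \<noteq> 0"
  have c: "continuous_on {s..t} g"
    using shortest_curve_continuous[OF g] by (rule continuous_on_subset) (use st in auto)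
  have c\<psi>: "continuous_on {s..t} (\<lambda>r. \<phi> (g r))"
    using continuous_on_compose2[OF \<phi>(2) c] st by auto
  have gX: "g r \<in> X" "g r \<in> U" using shortest_curve_mem[OF g, of r] st r by auto
  then have pos: "\<phi> (g r) > 0" using X nz by fastforce
  with side gX have sideX: "{p \<in> U. \<phi> p > 0} \<subseteq> X" by blast
  obtain r0 where r0: "r0 \<in> {s..t}" "\<And>u. u \<in> {s..t} \<Longrightarrow> \<phi> (g u) \<le> \<phi> (g r0)"
    using continuous_attains_sup[OF _ _ c\<psi>] r by auto
  define m where "m = \<phi> (g r0)"
  have m: "m > 0" using pos r0(2)[OF r] by (simp add: m_def)
  define M where "M = {u \<in> {s..t}. \<phi> (g u) = m}"
  have "closed M" unfolding M_def by (rule continuous_closed_preimage_constant[OF c\<psi>]) auto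
  have "r0 \<in> M" using r0 by (simp add: M_def m_def)
  define r1 where "r1 = Sup M"
  have bM: "bdd_above M" unfolding M_def by (rule bdd_aboveI[of _ t]) auto
  have r1M: "r1 \<in> M" unfolding r1_def
    using \<open>r0 \<in> M\<close> bM \<open>closed M\<close> by (intro closed_contains_Sup) auto
  have r1: "r1 \<in> {s..t}" "\<phi> (g r1) = m" using r1M by (auto simp: M_def)
  have after: "\<phi> (g u) < m" if "u \<in> {s..t}" "r1 < u" for u
  proof -
    have "u \<notin> M" using cSup_upper[OF _ bM, of u] that by (auto simp: r1_def)
    then have "\<phi> (g u) \<noteq> m" using that by (auto simp: M_def)
    then show ?thesis using r0(2)[OF that(1)] by (simp add: m_def)
  qed
  \<comment> \<open>The curve may rest at \<open>g r1\<close> or visit it earlier, so a parameter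
    just before \<open>r1\<close> could give the same point and a degenerate chord. Starting just
    before the first visit \<open>c0\<close> ensures that \<open>g u\<close> differs from
    \<open>g r1\<close>; ending after the last maximum \<open>r1\<close> gives the strict inequality
    at \<open>g v\<close>.\<close>
  define N where "N = {u \<in> {s..t}. g u = g r1}"
  have "closed N" unfolding N_def by (rule continuous_closed_preimage_constant[OF c]) auto
  have bN: "bdd_below N" unfolding N_def by (rule bdd_belowI[of _ s]) auto
  define c0 where "c0 = Inf N"
  have "r1 \<in> N" using r1 by (simp add: N_def)
  have "c0 \<in> N" unfolding c0_def
    using \<open>r1 \<in> N\<close> bN \<open>closed N\<close> by (intro closed_contains_Inf) auto
  then have c0: "c0 \<in> {s..t}" "g c0 = g r1" by (auto simp: N_def)
  have c0r1: "c0 \<le> r1" unfolding c0_def using \<open>r1 \<in> N\<close> bN by (rule cInf_lower)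
  have before: "g u \<noteq> g r1" if "u \<in> {s..t}" "u < c0" for u
    using cInf_lower[OF _ bN, of u] that by (auto simp: c0_def N_def)
  have "s < c0" "r1 < t"
    using st c0 r1 m by (auto simp: less_le)
  have "open {p \<in> U. \<phi> p > 0}"
    using continuous_open_preimage[OF \<phi>(2) U, of "{0<..}"] by (simp add: vimage_def Int_def)
  moreover have "g r1 \<in> {p \<in> U. \<phi> p > 0}" using r1 m st by auto
  ultimately obtain \<epsilon> where \<epsilon>: "\<epsilon> > 0" "ball (g r1) \<epsilon> \<subseteq> {p \<in> U. \<phi> p > 0}"
    using open_contains_ball by meson
  obtain d where d: "d > 0" "\<And>u. u \<in> {s..t} \<Longrightarrow> dist u c0 < d \<Longrightarrow> dist (g u) (g c0) < \<epsilon>"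
    using c c0 \<epsilon> unfolding continuous_on_iff by meson
  obtain d' where d': "d' > 0" "\<And>u. u \<in> {s..t} \<Longrightarrow> dist u r1 < d' \<Longrightarrow> dist (g u) (g r1) < \<epsilon>"
    using c r1 \<epsilon> unfolding continuous_on_iff by meson
  define u where "u = max s (c0 - d/2)"
  define v where "v = min t (r1 + d'/2)"
  have u: "u \<in> {s..t}" "u < c0" using \<open>s < c0\<close> c0 d(1) by (auto simp: u_def)
  have v: "v \<in> {s..t}" "r1 < v" using \<open>r1 < t\<close> r1 d'(1) by (auto simp: v_def)
  have "dist u c0 < d" "dist v r1 < d'"
    using u v d(1) d'(1) by (auto simp: u_def v_def dist_real_def)
  then have ball: "g u \<in> ball (g r1) \<epsilon>" "g v \<in> ball (g r1) \<epsilon>"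
    using d(2)[of u] d'(2)[of v] u v c0 by (auto simp: dist_commute)
  then have "closed_segment (g u) (g v) \<subseteq> ball (g r1) \<epsilon>" by (intro closed_segment_subset) auto
  then have "closed_segment (g u) (g v) \<subseteq> X" using \<epsilon> sideX by blast
  then have "g ` {u..v} = closed_segment (g u) (g v)"
    using u v c0r1 st by (intro shortest_curve_segment[OF g]) auto
  moreover have "r1 \<in> {u..v}" using u v c0r1 by auto
  ultimately have "g r1 \<in> closed_segment (g u) (g v)" by blast
  then obtain w where w: "0 \<le> w" "w \<le> 1" "g r1 = (1 - w) *\<^sub>R g u + w *\<^sub>R g v"
    by (auto simp: in_segment)
  have "w \<noteq> 0" using w before[OF u] by auto
  have "m \<le> (1 - w) * \<phi> (g u) + w * \<phi> (g v)"
    using convex_onD[OF \<phi>(1) w(1,2), of "g u" "g v"] w(3) r1 st(3) subsetD[OF st(3), OF imageI, OF u(1)]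
      subsetD[OF st(3), OF imageI, OF v(1)] by simp
  also have "\<dots> < (1 - w) * m + w * m"
  proof (intro add_le_less_mono mult_left_mono mult_strict_left_mono)
    show "\<phi> (g u) \<le> m" using r0(2)[OF u(1)] by (simp add: m_def)
  qed (use w \<open>w \<noteq> 0\<close> after[OF v] in auto)
  finally show False by (simp add: algebra_simps)
qed

text \<open>Via \<open>\<pi>\<close> and its inverse \<open>\<rho>\<close>, the set \<open>E\<close>
  is a copy of a subset of the line, where connected sets are intervals and intersect in
  intervals.\<close>

lemma connected_Int_graph:
  fixes \<pi> :: "pt \<Rightarrow> real" and \<rho> :: "real \<Rightarrow> pt"
  assumes "continuous_on E \<pi>" "continuous_on (\<pi> ` E) \<rho>" "\<And>p. p \<in> E \<Longrightarrow> \<rho> (\<pi> p) = p"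
    and "C \<subseteq> E" "D \<subseteq> E" "connected C" "connected (\<pi> ` D)"
  shows "connected (C \<inter> D)"
proof -
  have "C \<inter> D = \<rho> ` (\<pi> ` C \<inter> \<pi> ` D)"
  proof
    show "C \<inter> D \<subseteq> \<rho> ` (\<pi> ` C \<inter> \<pi> ` D)" using assms by force
    show "\<rho> ` (\<pi> ` C \<inter> \<pi> ` D) \<subseteq> C \<inter> D" using assms(3-5) by (auto; metis subsetD)
  qed
  moreover have "connected (\<pi> ` C)"
    using assms by (intro connected_continuous_image) (auto intro: continuous_on_subset)
  then have "connected (\<pi> ` C \<inter> \<pi> ` D)"
    using assms(7) by (simp add: is_interval_connected_1[symmetric] is_interval_Int)
  then have "connected (\<rho> ` (\<pi> ` C \<inter> \<pi> ` D))"
    using assms(4) by (intro connected_continuous_image continuous_on_subset[OF assms(2)]) auto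
  ultimately show ?thesis by simp
qed

text \<open>By uniform continuity the curve moves less than \<open>\<delta>\<close> during each of
  \<open>N\<close> equal time intervals. If it meets \<open>e\<close> in one of them, it stays in
  \<open>U\<close> there, and the maximum principle makes the times spent on the boundary an
  interval. So each time interval contributes at most one connected piece.\<close>

lemma tame_superlevel_boundary:
  fixes \<phi> :: "pt \<Rightarrow> real" and \<pi> :: "pt \<Rightarrow> real" and \<rho> :: "real \<Rightarrow> pt"
  assumes one: "one_cell e" and U: "open U"
    and \<phi>: "convex_on U \<phi>" "continuous_on U \<phi>"
    and X: "\<And>p. p \<in> X \<Longrightarrow> p \<in> U \<Longrightarrow> \<phi> p \<ge> 0"
    and side: "{p \<in> U. \<phi> p > 0} \<subseteq> X \<or> {p \<in> U. \<phi> p > 0} \<inter> X = {}"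
    and \<delta>: "\<delta> > 0" "\<And>z. z \<in> e \<Longrightarrow> ball z \<delta> \<subseteq> U"
    and E: "E = {p \<in> U. \<phi> p = 0}" "e \<subseteq> E"
    and graph: "continuous_on E \<pi>" "continuous_on (\<pi> ` E) \<rho>" "\<And>p. p \<in> E \<Longrightarrow> \<rho> (\<pi> p) = p"
    and conn: "connected (\<pi> ` e)"
  shows "tame_cell X e"
proof (rule tame_one_cell[OF one])
  fix A B g assume g: "shortest_curve X A B g"
  have "uniformly_continuous_on {0..1} g"
    using shortest_curve_continuous[OF g] by (intro compact_uniformly_continuous) auto
  then obtain \<eta> where \<eta>: "\<eta> > 0"
    "\<And>r r'. r \<in> {0..1} \<Longrightarrow> r' \<in> {0..1} \<Longrightarrow> dist r' r < \<eta> \<Longrightarrow> dist (g r') (g r) < \<delta>"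
    using \<delta>(1) unfolding uniformly_continuous_on_def by metis
  obtain N :: nat where N: "N > 0" "1 / real N < \<eta>"
    using real_arch_inverse[of \<eta>] \<eta>(1) by (auto simp: inverse_eq_divide)
  define I where "I k = {real k / real N..real (Suc k) / real N}" for k
  have I01: "I k \<subseteq> {0..1}" if "k < N" for k
    using that by (auto simp: I_def field_simps)
  have cover: "{0..1} \<subseteq> (\<Union>k<N. I k)"
  proof
    fix r :: real assume r: "r \<in> {0..1}"
    show "r \<in> (\<Union>k<N. I k)"
    proof (cases "r = 1")
      case True
      \<comment> \<open>The floor would yield the index \<open>N\<close> for the right end of the
        unit interval, one too many.\<close>
      have "r \<in> I (N - 1)" using True N by (auto simp: I_def field_simps of_nat_diff)
      then show ?thesis using N by auto
    next
      case False
      define k where "k = nat \<lfloor>r * N\<rfloor>"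
      have "0 \<le> r * N" using r by simp
      then have "real k = of_int \<lfloor>r * N\<rfloor>" by (simp add: k_def)
      then have k: "real k \<le> r * N" "r * N < real k + 1" by linarith+
      have "r * N < N" using r False N mult_strict_right_mono[of r 1 "real N"] by auto
      then have "k < N" using k by linarith
      moreover have "r \<in> I k" using k N by (auto simp: I_def field_simps)
      ultimately show ?thesis by blast
    qed
  qed
  have "connected (g ` I k \<inter> e)" if k: "k < N" for k
  proof (cases "g ` I k \<inter> e = {}")
    case False
    then obtain r where r: "r \<in> I k" "g r \<in> e" by blast
    have sub: "g ` I k \<subseteq> U"
    proof
      fix x assume "x \<in> g ` I k"
      then obtain r' where r': "r' \<in> I k" "x = g r'" by blast
      have "real (Suc k) / N = real k / N + 1 / N" by (simp add: add_divide_distrib)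
      moreover have "real k / N \<le> r" "r \<le> real (Suc k) / N" "real k / N \<le> r'" "r' \<le> real (Suc k) / N"
        using r(1) r'(1) unfolding I_def atLeastAtMost_iff by blast+
      ultimately have "dist r r' \<le> 1 / N"
        unfolding dist_real_def by linarith
      then have "dist (g r) (g r') < \<delta>"
        using \<eta>(2)[OF subsetD[OF I01[OF k] r'(1)] subsetD[OF I01[OF k] r(1)]] N by linarith
      then show "x \<in> U" using \<delta>(2)[OF r(2)] r' by auto
    qed
    \<comment> \<open>The times on the boundary \<open>E\<close>, which extends beyond
      \<open>e\<close>. The image of \<open>J\<close> is connected in \<open>E\<close>; cutting it
      down to \<open>e\<close> keeps it connected because \<open>E\<close> is parametrized by a real
      coordinate.\<close>
    define J where "J = {r \<in> I k. \<phi> (g r) = 0}"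
    have "is_interval J"
      unfolding is_interval_1
    proof (intro ballI allI impI)
      fix a b x assume ab: "a \<in> J" "b \<in> J" "a \<le> x \<and> x \<le> b"
      then have "{a..b} \<subseteq> I k" by (auto simp: J_def I_def)
      moreover have "x \<in> I k" using ab \<open>{a..b} \<subseteq> I k\<close> by auto
      moreover have "0 \<le> a" "b \<le> 1" using ab I01[OF k] by (auto simp: J_def)
      moreover have "\<phi> (g a) = 0" "\<phi> (g b) = 0" using ab by (auto simp: J_def)
      moreover have "g ` {a..b} \<subseteq> U" using sub \<open>{a..b} \<subseteq> I k\<close> by blast
      ultimately show "x \<in> J"
        using shortest_curve_stays_on_boundary[OF g U \<phi> X side, of a b x] ab by (simp add: J_def)
    qed
    then have "connected J" by (simp add: is_interval_connected_1)
    moreover have "continuous_on J g"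
      using shortest_curve_continuous[OF g] by (rule continuous_on_subset) (use I01[OF k] in \<open>auto simp: J_def\<close>)
    ultimately have "connected (g ` J)" by (intro connected_continuous_image)
    moreover have "g ` J \<subseteq> E" using sub E by (auto simp: J_def)
    ultimately have "connected (g ` J \<inter> e)"
      using connected_Int_graph[OF graph _ E(2) _ conn] by blast
    moreover have "g ` I k \<inter> e = g ` J \<inter> e" using E by (auto simp: J_def)
    ultimately show ?thesis by simp
  qed auto
  then have "finite (components (\<Union>((\<lambda>k. g ` I k \<inter> e) ` {..<N})))"
    by (intro finite_components_Union) auto
  moreover have "path_image g = (\<Union>k<N. g ` I k)"
    unfolding path_image_def using cover I01 by blast
  then have "path_image g \<inter> e = \<Union>((\<lambda>k. g ` I k \<inter> e) ` {..<N})"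
    by blast
  ultimately show "finite (components (path_image g \<inter> e))" by simp
qed

section \<open>Bivariate polynomials and implicit functions\<close>

text \<open>A bivariate polynomial is a polynomial in \<open>y\<close> (the second coordinate) whose coefficients are
  polynomials in \<open>x\<close>.\<close>
definition ev :: "real poly poly \<Rightarrow> pt \<Rightarrow> real" where
  "ev q z = poly (poly q [:snd z:]) (fst z)"

lemma ev_pCons: "ev (pCons c q) z = poly c (fst z) + snd z * ev q z"
  by (simp add: ev_def)

lemma ev_simps [simp]:
  "ev 0 z = 0" "ev 1 z = 1" "ev (p + q) z = ev p z + ev q z" "ev (- p) z = - ev p z"
  "ev (p - q) z = ev p z - ev q z" "ev (p * q) z = ev p z * ev q z"
  "ev (sum f A) z = (\<Sum>i\<in>A. ev (f i) z)" "ev (prod f A) z = (\<Prod>i\<in>A. ev (f i) z)"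
  "ev [:c:] z = poly c (fst z)"
  by (simp_all add: ev_def poly_sum poly_prod)

lemma ev_monom: "ev (monom c j) z = poly c (fst z) * snd z ^ j"
  by (simp add: ev_def poly_monom poly_power)

lemma ev_altdef: "ev q z = (\<Sum>j\<le>degree q. poly (coeff q j) (fst z) * snd z ^ j)"
  by (simp add: ev_def poly_altdef[of q] poly_sum poly_power)

lemma ev_dvd: "p dvd q \<Longrightarrow> ev p z = 0 \<Longrightarrow> ev q z = 0"
  by (auto elim: dvdE)

lemma ev_column: "ev q (x, y) = poly (map_poly (\<lambda>c. poly c x) q) y"
  by (induction q) (simp_all add: ev_pCons map_poly_pCons)

lemma poly2_imp_ev:
  assumes "poly2 f"
  shows "\<exists>q. f = ev q"
proof -
  obtain N c where f: "\<And>x y. f (x, y) = (\<Sum>i\<le>N. \<Sum>j\<le>N. c i j * x ^ i * y ^ j)"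
    using assms unfolding poly2_def by blast
  have "f z = ev (\<Sum>i\<le>N. \<Sum>j\<le>N. monom (monom (c i j) i) j) z" for z
    using f[of "fst z" "snd z"] by (simp add: ev_monom poly_monom)
  then show ?thesis by blast
qed

lemma poly2_ev: "poly2 (ev q)"
proof -
  define N where "N = degree q + (\<Sum>j\<le>degree q. degree (coeff q j))"
  have d: "degree (coeff q j) \<le> N" for j
  proof (cases "j \<le> degree q")
    case True
    then have "degree (coeff q j) \<le> (\<Sum>j\<le>degree q. degree (coeff q j))"
      by (intro member_le_sum) auto
    then show ?thesis by (simp add: N_def)
  qed (simp add: coeff_eq_0)
  have p: "poly (coeff q j) x = (\<Sum>i\<le>N. coeff (coeff q j) i * x ^ i)" for j x
    unfolding poly_altdef using d[of j]
    by (intro sum.mono_neutral_left) (auto simp: coeff_eq_0)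
  have "ev q (x, y) = (\<Sum>i\<le>N. \<Sum>j\<le>N. coeff (coeff q j) i * x ^ i * y ^ j)" for x y
  proof -
    have "ev q (x, y) = (\<Sum>j\<le>N. poly (coeff q j) x * y ^ j)"
      unfolding ev_altdef fst_conv snd_conv
      by (intro sum.mono_neutral_left) (auto simp: coeff_eq_0 N_def)
    also have "\<dots> = (\<Sum>j\<le>N. \<Sum>i\<le>N. coeff (coeff q j) i * x ^ i * y ^ j)"
      by (simp add: p sum_distrib_right)
    also have "\<dots> = (\<Sum>i\<le>N. \<Sum>j\<le>N. coeff (coeff q j) i * x ^ i * y ^ j)"
      by (rule sum.swap)
    finally show ?thesis .
  qed
  then show ?thesis unfolding poly2_def by (intro exI[of _ N] exI) auto
qed

lemma continuous_on_ev: "continuous_on A (ev q)"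
proof -
  have "ev q = (\<lambda>z. \<Sum>j\<le>degree q. poly (coeff q j) (fst z) * snd z ^ j)"
    by (rule ext) (rule ev_altdef)
  then show ?thesis by (simp add: continuous_intros)
qed

section \<open>Finiteness of common zeros by elimination of y\<close>

lemma finite_column_roots:
  assumes "\<not> [:[:-x, 1:]:] dvd q"
  shows "finite {y. ev q (x, y) = 0}"
proof (rule ccontr)
  assume "infinite {y. ev q (x, y) = 0}"
  then have "map_poly (\<lambda>c. poly c x) q = 0"
    using poly_roots_finite[of "map_poly (\<lambda>c. poly c x) q"] by (auto simp: ev_column)
  then have "poly (coeff q n) x = 0" for n
    using coeff_map_poly[of "\<lambda>c. poly c x" q n] by simp
  then show False using assms by (simp add: const_poly_dvd_iff poly_eq_0_iff_dvd)
qed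

text \<open>A substitute for the resultant: choose a nonzero \<open>r\<close> of least degree in y
  in the ideal of \<open>p\<close> and \<open>q\<close>. By pseudo-division \<open>r\<close> divides
  nonzero x-multiples of both. If \<open>p\<close> divided \<open>r\<close>, it would divide such a
  multiple of \<open>q\<close> and hence \<open>q\<close>; so \<open>p\<close> divides the cofactor,
  and cancelling \<open>p\<close> leaves \<open>r\<close> as a divisor of a polynomial in x
  alone.\<close>

lemma prime_elem_elimination:
  fixes p q :: "real poly poly"
  assumes p: "prime_elem p" "degree p > 0" and q: "\<not> p dvd q"
  obtains a b r where "r \<noteq> 0" "a * p + b * q = [:r:]"
proof -
  let ?I = "\<lambda>r. r \<noteq> 0 \<and> (\<exists>a b. a * p + b * q = r)"
  have "0 * p + 1 * q = q" "q \<noteq> 0" using q by auto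
  then have "?I q" by metis
  then obtain r where r: "?I r" and min: "\<And>s. ?I s \<Longrightarrow> degree r \<le> degree s"
    using ex_has_least_nat[of ?I q degree] by blast
  obtain a b where ab: "a * p + b * q = r" using r by blast
  have divides: "\<exists>c d. c \<noteq> 0 \<and> smult c u = r * d" if u: "u = a' * p + b' * q" for u a' b'
  proof -
    obtain d s where ds: "pseudo_divmod u r = (d, s)" by fastforce
    define c where "c = coeff r (degree r) ^ (Suc (degree u) - degree r)"
    have e: "smult c u = r * d + s" and s: "s = 0 \<or> degree s < degree r"
      using pseudo_divmod[OF _ ds] r by (auto simp: c_def)
    have "s = (smult c a' - a * d) * p + (smult c b' - b * d) * q"
      using e unfolding u ab[symmetric] by (simp add: algebra_simps smult_add_right)
    then have "s = 0" using min[of s] s by (metis not_le)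
    moreover have "c \<noteq> 0" using r by (simp add: c_def)
    ultimately show ?thesis using e by auto
  qed
  obtain c d where cd: "c \<noteq> 0" "smult c p = r * d" using divides[of p 1 0] by auto
  obtain c' d' where cd': "c' \<noteq> 0" "smult c' q = r * d'" using divides[of q 0 1] by auto
  have ndvd: "\<not> p dvd [:k:]" if "k \<noteq> 0" for k
    using dvd_imp_degree_le[of p "[:k:]"] p(2) that by auto
  have "p dvd r * d" using cd by (metis dvd_refl dvd_smult)
  then have "p dvd r \<or> p dvd d" using p(1) by (simp add: prime_elem_dvd_mult_iff)
  then have "degree r = 0"
  proof
    assume "p dvd r"
    then have "p dvd [:c':] * q" using cd'(2) by simp
    then show ?thesis using p(1) ndvd[OF cd'(1)] q by (simp only: prime_elem_dvd_mult_iff) simp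
  next
    assume "p dvd d"
    then obtain k where "d = p * k" by (elim dvdE)
    then have "p * [:c:] = p * (r * k)" using cd(2) by (simp add: mult.commute mult.left_commute)
    then have e: "[:c:] = r * k" using p(2) by (subst (asm) mult_cancel_left) auto
    then have "k \<noteq> 0" using cd(1) by auto
    then have "degree [:c:] = degree r + degree k" using e r by (simp add: degree_mult_eq)
    then show ?thesis by simp
  qed
  then obtain r' where "r = [:r':]" by (rule degree_eq_zeroE)
  then show thesis using that[of r' a b] ab r by auto
qed

text \<open>If \<open>p\<close> is free of y, its zeros are finitely many vertical lines, and
  \<open>q\<close> has finitely many zeros on each, since otherwise a linear factor associated to
  \<open>p\<close> would divide \<open>q\<close>. If not, an eliminated polynomial in x leaves
  finitely many columns, and no linear polynomial in x divides \<open>p\<close>, so \<open>p\<close>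
  has finitely many zeros on each column.\<close>

lemma finite_common_zeros:
  assumes p: "prime_elem p" and q: "\<not> p dvd q"
  shows "finite {z. ev p z = 0 \<and> ev q z = 0}"
proof -
  have irr: "irreducible p" using p by (rule prime_elem_imp_irreducible)
  have linear: "p dvd [:[:-x, 1:]:]" if "[:[:-x, 1:]:] dvd p" for x
    using irreducibleD'[OF irr that] by (simp add: is_unit_const_poly_iff is_unit_poly_iff)
  show ?thesis
  proof (cases "degree p = 0")
    case True
    then obtain c where c: "p = [:c:]" by (rule degree_eq_zeroE)
    have "c \<noteq> 0" using p c by auto
    have "finite {y. ev q (x, y) = 0}" if "poly c x = 0" for x
    proof (rule finite_column_roots)
      have "[:[:-x, 1:]:] dvd p" using that c by (simp add: poly_eq_0_iff_dvd)
      then show "\<not> [:[:-x, 1:]:] dvd q" using linear q dvd_trans by blast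
    qed
    then have "finite (\<Union>x\<in>{x. poly c x = 0}. {x} \<times> {y. ev q (x, y) = 0})"
      using poly_roots_finite[OF \<open>c \<noteq> 0\<close>] by auto
    then show ?thesis by (rule rev_finite_subset) (auto simp: c)
  next
    case False
    then have "degree p > 0" by simp
    then obtain r a b where r: "r \<noteq> 0" "a * p + b * q = [:r:]"
      by (rule prime_elem_elimination[OF p _ q])
    have "poly r (fst z) = 0" if "ev p z = 0" "ev q z = 0" for z
    proof -
      have "ev (a * p + b * q) z = 0" using that by simp
      then show ?thesis unfolding r(2) by simp
    qed
    moreover have "finite {y. ev p (x, y) = 0}" for x
    proof (rule finite_column_roots)
      show "\<not> [:[:-x, 1:]:] dvd p"
        using linear[of x] False dvd_imp_degree_le[of p "[:[:-x, 1:]:]"] by auto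
    qed
    then have "finite (\<Union>x\<in>{x. poly r x = 0}. {x} \<times> {y. ev p (x, y) = 0})"
      using poly_roots_finite[OF r(1)] by auto
    ultimately show ?thesis by (rule_tac rev_finite_subset) force+
  qed
qed

section \<open>Partial derivatives and implicit functions\<close>

abbreviation dx :: "real poly poly \<Rightarrow> real poly poly" where "dx \<equiv> map_poly pderiv"

text \<open>The chain rule along a graph: y is the outer variable, so \<open>pderiv\<close> is the
  partial derivative in y, while \<open>dx\<close> differentiates the coefficients.\<close>

lemma DERIV_ev_graph:
  assumes "(f has_real_derivative d) (at x)"
  shows "((\<lambda>x. ev q (x, f x)) has_real_derivative
     ev (dx q) (x, f x) + ev (pderiv q) (x, f x) * d) (at x)"
proof (induction q)
  case (pCons c q)
  show ?case
    unfolding ev_pCons fst_conv snd_conv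
    by (rule DERIV_cong[OF DERIV_add[OF poly_DERIV DERIV_mult[OF assms pCons.IH]]])
       (simp add: map_poly_pCons ev_pCons pderiv_pCons algebra_simps)
qed simp

lemma DERIV_ev_snd: "((\<lambda>y. ev q (x, y)) has_real_derivative ev (pderiv q) (x, y)) (at y)"
proof (induction q)
  case (pCons c q)
  show ?case
    unfolding ev_pCons fst_conv snd_conv
    by (rule DERIV_cong[OF DERIV_add[OF DERIV_const DERIV_mult[OF DERIV_ident pCons.IH]]])
       (simp add: ev_pCons pderiv_pCons)
qed simp

text \<open>\<open>R\<close> is the divided difference in y, extended continuously across the
  diagonal by the partial derivative. It allows an implicit function to be differentiated knowing
  only that it is continuous.\<close>

lemma ev_difference_quotient:
  "\<exists>R. continuous_on UNIV R \<and> (\<forall>x y z. ev q (x, y) - ev q (x, z) = (y - z) * R (x, y, z)) \<and>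
    (\<forall>x y. R (x, y, y) = ev (pderiv q) (x, y))"
proof (induction q)
  case 0
  show ?case by (intro exI[of _ "\<lambda>_. 0"]) auto
next
  case (pCons c q)
  then obtain R where R: "continuous_on UNIV R"
    "\<And>x y z. ev q (x, y) - ev q (x, z) = (y - z) * R (x, y, z)"
    "\<And>x y. R (x, y, y) = ev (pderiv q) (x, y)" by blast
  let ?R = "\<lambda>w. ev q (fst w, fst (snd w)) + snd (snd w) * R w"
  have "continuous_on UNIV ?R"
    by (intro continuous_intros R(1) continuous_on_compose2[OF continuous_on_ev[of UNIV q]]) auto
  moreover have "ev (pCons c q) (x, y) - ev (pCons c q) (x, z) = (y - z) * ?R (x, y, z)" for x y z
  proof -
    have "ev (pCons c q) (x, y) - ev (pCons c q) (x, z)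
      = (y - z) * ev q (x, y) + z * (ev q (x, y) - ev q (x, z))"
      by (simp add: ev_pCons algebra_simps)
    then show ?thesis by (simp add: R(2) algebra_simps)
  qed
  moreover have "?R (x, y, y) = ev (pderiv (pCons c q)) (x, y)" for x y
    by (simp add: R(3) pderiv_pCons ev_pCons)
  ultimately show ?case by blast
qed

text \<open>The vanishing difference of \<open>q\<close> between \<open>(u, f u)\<close> and
  \<open>(x, f x)\<close> is split at \<open>(u, f x)\<close>: the first part is
  \<open>f u - f x\<close> times \<open>R\<close>, the second a difference quotient in x after
  division by \<open>u - x\<close>. Solve for the quotient of \<open>f\<close> and let
  \<open>u\<close> tend to \<open>x\<close>.\<close>

lemma DERIV_implicit:
  fixes f :: "real \<Rightarrow> real"
  assumes S: "open S" "x \<in> S" and f: "continuous_on S f" "\<And>u. u \<in> S \<Longrightarrow> ev q (u, f u) = 0"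
    and nz: "ev (pderiv q) (x, f x) \<noteq> 0"
  shows "(f has_real_derivative - ev (dx q) (x, f x) / ev (pderiv q) (x, f x)) (at x)"
proof -
  obtain R where R: "continuous_on UNIV R"
    "\<And>x y z. ev q (x, y) - ev q (x, z) = (y - z) * R (x, y, z)"
    "\<And>x y. R (x, y, y) = ev (pderiv q) (x, y)" using ev_difference_quotient by blast
  have "((\<lambda>u. ev q (u, f x)) has_real_derivative ev (dx q) (x, f x)) (at x)"
    using DERIV_ev_graph[of "\<lambda>_. f x" 0 x q] by simp
  then have D: "(\<lambda>u. (ev q (u, f x) - ev q (x, f x)) / (u - x)) \<midarrow>x\<rightarrow> ev (dx q) (x, f x)"
    by (simp add: has_field_derivative_iff)
  have "f \<midarrow>x\<rightarrow> f x" using f(1) S by (metis continuous_on_eq_continuous_at isCont_def)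
  then have "(\<lambda>u. (u, f u, f x)) \<midarrow>x\<rightarrow> (x, f x, f x)" by (intro tendsto_intros)
  moreover have "isCont R (x, f x, f x)" using R(1) by (simp add: continuous_on_eq_continuous_at)
  ultimately have L: "(\<lambda>u. R (u, f u, f x)) \<midarrow>x\<rightarrow> ev (pderiv q) (x, f x)"
    unfolding R(3)[symmetric] by (rule isCont_tendsto_compose[rotated])
  have lim: "(\<lambda>u. - ((ev q (u, f x) - ev q (x, f x)) / (u - x)) / R (u, f u, f x))
      \<midarrow>x\<rightarrow> - ev (dx q) (x, f x) / ev (pderiv q) (x, f x)"
    by (intro tendsto_intros D L nz)
  have "eventually (\<lambda>u. R (u, f u, f x) \<noteq> 0) (at x)"
    using L nz by (rule tendsto_imp_eventually_ne)
  moreover have "eventually (\<lambda>u. u \<in> S) (at x)" using S by (rule eventually_at_in_open')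
  moreover have "eventually (\<lambda>u. u \<noteq> x) (at x)" by (simp add: eventually_at_filter)
  ultimately have "eventually (\<lambda>u. (f u - f x) / (u - x)
      = - ((ev q (u, f x) - ev q (x, f x)) / (u - x)) / R (u, f u, f x)) (at x)"
  proof eventually_elim
    case (elim u)
    define A where "A = ev q (u, f x) - ev q (x, f x)"
    have "ev q (u, f u) - ev q (u, f x) = (f u - f x) * R (u, f u, f x)" by (rule R(2))
    then have "f u - f x = - A / R (u, f u, f x)"
      using f(2)[OF elim(2)] f(2)[OF S(2)] elim(1) by (simp add: field_simps A_def)
    then show ?case unfolding A_def[symmetric] by (simp add: mult.commute)
  qed
  then show ?thesis
    unfolding has_field_derivative_iff using lim by (simp add: tendsto_cong)
qed

text \<open>The height \<open>{c<..<d}\<close> is fixed by \<open>W\<close>, and the base is then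
  narrowed until \<open>q\<close> is negative on the lower and positive on the upper edge.
  Monotonicity in y and the intermediate value theorem give exactly one zero per column.\<close>

lemma implicit_function_pos:
  assumes W: "open W" "(x0, y0) \<in> W" and z: "ev q (x0, y0) = 0" and pos: "\<And>w. w \<in> W \<Longrightarrow> ev (pderiv q) w > 0"
  shows "\<exists>a b c d f. x0 \<in> {a<..<b} \<and> y0 \<in> {c<..<d} \<and> {a<..<b} \<times> {c<..<d} \<subseteq> W \<and>
    (\<forall>x\<in>{a<..<b}. f x \<in> {c<..<d} \<and> (\<forall>y\<in>{c<..<d}. ev q (x, y) = 0 \<longleftrightarrow> y = f x)) \<and>
    continuous_on {a<..<b} f"
proof -
  obtain A B where AB: "open A" "open B" "x0 \<in> A" "y0 \<in> B" "A \<times> B \<subseteq> W"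
    using W unfolding open_prod_def by force
  obtain r where r: "r > 0" "cball y0 r \<subseteq> B" using AB open_contains_cball by meson
  define c where "c = y0 - r"
  define d where "d = y0 + r"
  have cd: "{c..d} \<subseteq> B" using r by (simp add: c_def d_def cball_eq_atLeastAtMost)
  have incr: "ev q (x, y) < ev q (x, y')" if "x \<in> A" "c \<le> y" "y < y'" "y' \<le> d" for x y y'
  proof (rule DERIV_pos_imp_increasing[OF \<open>y < y'\<close>])
    fix u assume "y \<le> u" "u \<le> y'"
    then have "(x, u) \<in> W" using that cd AB by fastforce
    then show "\<exists>D. ((\<lambda>y. ev q (x, y)) has_real_derivative D) (at u) \<and> 0 < D"
      using pos DERIV_ev_snd by blast
  qed
  have y0: "y0 \<in> {c<..<d}" using r by (auto simp: c_def d_def)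
  define A' where "A' = A \<inter> {x. ev q (x, c) < 0} \<inter> {x. ev q (x, d) > 0}"
  have cont: "continuous_on UNIV (\<lambda>x. ev q (x, y))" for y
    by (intro continuous_on_compose2[OF continuous_on_ev[of UNIV q]] continuous_intros) auto
  have "open A'" unfolding A'_def
    using AB cont by (intro open_Int open_Collect_less) (auto intro: continuous_intros)
  moreover have "x0 \<in> A'" unfolding A'_def
    using AB incr[of x0 c y0] incr[of x0 y0 d] y0 z by auto
  ultimately obtain \<epsilon> where \<epsilon>: "\<epsilon> > 0" "ball x0 \<epsilon> \<subseteq> A'" using open_contains_ball by meson
  define a where "a = x0 - \<epsilon>"
  define b where "b = x0 + \<epsilon>"
  have ab: "{a<..<b} \<subseteq> A'" using \<epsilon> by (simp add: a_def b_def ball_eq_greaterThanLessThan)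
  define f where "f x = (SOME y. y \<in> {c<..<d} \<and> ev q (x, y) = 0)" for x
  have f: "f x \<in> {c<..<d} \<and> ev q (x, f x) = 0" if x: "x \<in> {a<..<b}" for x
  proof -
    have s: "ev q (x, c) < 0" "ev q (x, d) > 0" using x ab by (auto simp: A'_def)
    have "\<exists>y\<ge>c. y \<le> d \<and> ev q (x, y) = 0"
      by (rule IVT) (use s y0 DERIV_isCont[OF DERIV_ev_snd] in auto)
    then obtain y where y: "c \<le> y" "y \<le> d" "ev q (x, y) = 0" by blast
    moreover have "y \<noteq> c" "y \<noteq> d" using y s by auto
    ultimately have "y \<in> {c<..<d} \<and> ev q (x, y) = 0" by auto
    then show ?thesis unfolding f_def by (rule someI)
  qed
  have uniq: "ev q (x, y) = 0 \<longleftrightarrow> y = f x" if x: "x \<in> {a<..<b}" and y: "y \<in> {c<..<d}" for x y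
  proof -
    have "x \<in> A" using x ab by (auto simp: A'_def)
    then show ?thesis
      using f[OF x] incr[of x y "f x"] incr[of x "f x" y] y by (cases y "f x" rule: linorder_cases) auto
  qed
  have "isCont f x1" if x1: "x1 \<in> {a<..<b}" for x1
    unfolding isCont_def
  proof (rule order_tendstoI)
    have x1A: "x1 \<in> A" using x1 ab by (auto simp: A'_def)
    have ev_in: "eventually (\<lambda>x. x \<in> {a<..<b}) (at x1)"
      using x1 by (intro eventually_at_in_open') auto
    fix l assume "l < f x1"
    \<comment> \<open>A level at least \<open>l\<close>, inside the box and below
      \<open>f x1\<close>. There \<open>q\<close> is negative at \<open>x1\<close>, hence also for
      nearby \<open>x\<close>, and monotonicity in y forces \<open>f x\<close> above
      \<open>m\<close>.\<close>
    define m where "m = max l ((c + f x1) / 2)"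
    have m: "c < m" "m < f x1" "l \<le> m" using \<open>l < f x1\<close> f[OF x1] by (auto simp: m_def less_max_iff_disj)
    have "ev q (x1, m) < 0" using incr[OF x1A, of m "f x1"] m f[OF x1] by auto
    moreover have "((\<lambda>x. ev q (x, m)) \<longlongrightarrow> ev q (x1, m)) (at x1)"
      using cont[of m] by (auto simp: continuous_on_eq_continuous_at isCont_def)
    ultimately have "eventually (\<lambda>x. ev q (x, m) < 0) (at x1)" by (rule order_tendstoD(2)[rotated])
    then show "eventually (\<lambda>x. l < f x) (at x1)" using ev_in
    proof eventually_elim
      case (elim x)
      have "x \<in> A" using elim ab by (auto simp: A'_def)
      then have "m < f x"
        using incr[of x "f x" m] f[OF elim(2)] elim m f[OF x1] by (cases "f x" m rule: linorder_cases) auto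
      then show ?case using m by simp
    qed
  next
    have x1A: "x1 \<in> A" using x1 ab by (auto simp: A'_def)
    have ev_in: "eventually (\<lambda>x. x \<in> {a<..<b}) (at x1)"
      using x1 by (intro eventually_at_in_open') auto
    fix l assume "f x1 < l"
    define m where "m = min l ((d + f x1) / 2)"
    have m: "m < d" "f x1 < m" "m \<le> l" using \<open>f x1 < l\<close> f[OF x1] by (auto simp: m_def min_less_iff_disj)
    have "ev q (x1, m) > 0" using incr[OF x1A, of "f x1" m] m f[OF x1] by auto
    moreover have "((\<lambda>x. ev q (x, m)) \<longlongrightarrow> ev q (x1, m)) (at x1)"
      using cont[of m] by (auto simp: continuous_on_eq_continuous_at isCont_def)
    ultimately have "eventually (\<lambda>x. ev q (x, m) > 0) (at x1)" by (rule order_tendstoD(1)[rotated])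
    then show "eventually (\<lambda>x. f x < l) (at x1)" using ev_in
    proof eventually_elim
      case (elim x)
      have "x \<in> A" using elim ab by (auto simp: A'_def)
      then have "f x < m"
        using incr[of x m "f x"] f[OF elim(2)] elim m f[OF x1] by (cases "f x" m rule: linorder_cases) auto
      then show ?case using m by simp
    qed
  qed
  then have "continuous_on {a<..<b} f" by (simp add: continuous_at_imp_continuous_on)
  moreover have "{a<..<b} \<times> {c<..<d} \<subseteq> A \<times> B"
  proof (intro Sigma_mono)
    show "{a<..<b} \<subseteq> A" using ab by (auto simp: A'_def)
    show "{c<..<d} \<subseteq> B" using cd by (meson greaterThanLessThan_subseteq_atLeastAtMost_iff order_refl order_trans)
  qed
  moreover have "x0 \<in> {a<..<b}" using \<epsilon> by (auto simp: a_def b_def)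
  moreover have "f x \<in> {c<..<d} \<and> (\<forall>y\<in>{c<..<d}. ev q (x, y) = 0 \<longleftrightarrow> y = f x)"
    if "x \<in> {a<..<b}" for x
    using f[OF that] uniq[OF that] by (intro conjI ballI) (rule conjunct1)
  ultimately show ?thesis
    using y0 order_trans[OF _ AB(5)]
    by (rule_tac exI[of _ a], rule_tac exI[of _ b], rule_tac exI[of _ c], rule_tac exI[of _ d],
        rule_tac exI[of _ f]) blast
qed

lemma implicit_function:
  assumes W: "open W" "z \<in> W" and z: "ev q z = 0" and nz: "ev (pderiv q) z \<noteq> 0"
  shows "\<exists>a b c d f. z \<in> {a<..<b} \<times> {c<..<d} \<and> {a<..<b} \<times> {c<..<d} \<subseteq> W \<and>
    (\<forall>x\<in>{a<..<b}. f x \<in> {c<..<d} \<and> (\<forall>y\<in>{c<..<d}. ev q (x, y) = 0 \<longleftrightarrow> y = f x)) \<and>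
    continuous_on {a<..<b} f"
proof -
  define p where "p = (if ev (pderiv q) z > 0 then q else - q)"
  have eq: "ev p w = 0 \<longleftrightarrow> ev q w = 0" for w by (simp add: p_def)
  define W' where "W' = W \<inter> {w. ev (pderiv p) w > 0}"
  have "open W'" unfolding W'_def
    using W by (intro open_Int open_Collect_less continuous_on_ev continuous_intros)
  moreover have "ev (pderiv p) z > 0" using nz by (simp add: p_def pderiv_minus)
  then have "(fst z, snd z) \<in> W'" using W by (simp add: W'_def)
  moreover have "ev p (fst z, snd z) = 0" using z eq by simp
  ultimately have "\<exists>a b c d f. fst z \<in> {a<..<b} \<and> snd z \<in> {c<..<d} \<and> {a<..<b} \<times> {c<..<d} \<subseteq> W' \<and>
    (\<forall>x\<in>{a<..<b}. f x \<in> {c<..<d} \<and> (\<forall>y\<in>{c<..<d}. ev p (x, y) = 0 \<longleftrightarrow> y = f x)) \<and>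
    continuous_on {a<..<b} f"
    by (rule implicit_function_pos) (simp add: W'_def)
  then obtain a b c d f where "fst z \<in> {a<..<b}" "snd z \<in> {c<..<d}" "{a<..<b} \<times> {c<..<d} \<subseteq> W'"
    "\<forall>x\<in>{a<..<b}. f x \<in> {c<..<d} \<and> (\<forall>y\<in>{c<..<d}. ev p (x, y) = 0 \<longleftrightarrow> y = f x)"
    "continuous_on {a<..<b} f" by blast
  then show ?thesis unfolding eq W'_def
    by (rule_tac exI[of _ a], rule_tac exI[of _ b], rule_tac exI[of _ c], rule_tac exI[of _ d],
        rule_tac exI[of _ f]) (simp add: mem_Times_iff)
qed

text \<open>Along the graph of an implicit function \<open>f\<close> of \<open>q\<close> one has
  \<open>f'' = - hess q / (pderiv q)^3\<close>.\<close>
definition hess :: "real poly poly \<Rightarrow> real poly poly" where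
  "hess q = (dx (dx q) * pderiv q - pderiv (dx q) * dx q) * pderiv q
     - dx q * (dx (pderiv q) * pderiv q - pderiv (pderiv q) * dx q)"

lemma DERIV_implicit_second:
  assumes "(f has_real_derivative - ev (dx q) (x, f x) / ev (pderiv q) (x, f x)) (at x)"
    and nz: "ev (pderiv q) (x, f x) \<noteq> 0"
  shows "((\<lambda>x. - ev (dx q) (x, f x) / ev (pderiv q) (x, f x)) has_real_derivative
    - ev (hess q) (x, f x) / ev (pderiv q) (x, f x) ^ 3) (at x)"
proof -
  \<comment> \<open>The quotient rule for f' = - u / v, where u and v are the first partial
    derivatives of \<open>q\<close> in x and y, and a, b, c, e stand for the second ones.\<close>
  have alg: "(- (a + b * (- u / v)) * v - (- u) * (c + e * (- u / v))) / (v * v)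
      = - ((a * v - b * u) * v - u * (c * v - e * u)) / v ^ 3" if "v \<noteq> 0" for a b c e u v :: real
    using that by (simp add: field_simps power3_eq_cube)
  note D = DERIV_ev_graph[OF assms(1)]
  show ?thesis
    by (rule DERIV_cong[OF DERIV_divide[OF DERIV_minus[OF D[of "dx q"]] D[of "pderiv q"] nz]])
       (simp only: alg[OF nz] hess_def ev_simps)
qed

text \<open>Weak monotonicity would be too little: the preimage of a point could be a closed
  interval, which is no cell. Constant functions are a case of their own.\<close>

definition regular_monotone_on :: "real set \<Rightarrow> (real \<Rightarrow> real) \<Rightarrow> bool" where
  "regular_monotone_on S f \<longleftrightarrow> (\<forall>x\<in>S. \<forall>y\<in>S. x < y \<longrightarrow> f x < f y) \<or>
     (\<forall>x\<in>S. \<forall>y\<in>S. x < y \<longrightarrow> f x > f y) \<or> (\<forall>x\<in>S. \<forall>y\<in>S. f x = f y)"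

lemma regular_monotone_onI:
  fixes f f' :: "real \<Rightarrow> real"
  assumes D: "\<And>x. x \<in> {a<..<b} \<Longrightarrow> (f has_real_derivative f' x) (at x)"
    and s: "(\<forall>x\<in>{a<..<b}. f' x > 0) \<or> (\<forall>x\<in>{a<..<b}. f' x < 0) \<or> (\<forall>x\<in>{a<..<b}. f' x = 0)"
  shows "regular_monotone_on {a<..<b} f"
proof -
  have mvt: "\<exists>z\<in>{a<..<b}. f y - f x = (y - x) * f' z"
    if "x \<in> {a<..<b}" "y \<in> {a<..<b}" "x < y" for x y
  proof -
    have "\<exists>z>x. z < y \<and> f y - f x = (y - x) * f' z"
      by (rule MVT2[OF \<open>x < y\<close>]) (use that D in auto)
    then show ?thesis using that by force
  qed
  from s consider "\<forall>x\<in>{a<..<b}. f' x > 0" | "\<forall>x\<in>{a<..<b}. f' x < 0" | "\<forall>x\<in>{a<..<b}. f' x = 0"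
    by blast
  then show ?thesis
  proof cases
    case 1
    have "f x < f y" if "x \<in> {a<..<b}" "y \<in> {a<..<b}" "x < y" for x y
      using mvt[OF that] 1 that mult_pos_pos[of "y - x"] by fastforce
    then show ?thesis unfolding regular_monotone_on_def by blast
  next
    case 2
    have "f x > f y" if "x \<in> {a<..<b}" "y \<in> {a<..<b}" "x < y" for x y
      using mvt[OF that] 2 that mult_pos_neg[of "y - x"] by fastforce
    then show ?thesis unfolding regular_monotone_on_def by blast
  next
    case 3
    have "f x = f y" if "x \<in> {a<..<b}" "y \<in> {a<..<b}" "x < y" for x y
      using mvt[OF that] 3 by auto
    then have "\<forall>x\<in>{a<..<b}. \<forall>y\<in>{a<..<b}. f x = f y"
      by (metis linorder_neqE_linordered_idom)
    then show ?thesis unfolding regular_monotone_on_def by blast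
  qed
qed

section \<open>Cells and dyadic partitions\<close>

text \<open>The products of two such sets are points, open axis-parallel segments and open
  rectangles, all of them cells.\<close>

definition interval_cell :: "real set \<Rightarrow> bool" where
  "interval_cell A \<longleftrightarrow> (\<exists>a. A = {a}) \<or> (\<exists>a b. a < b \<and> A = {a<..<b})"

lemma interval_cell_convex: "interval_cell A \<Longrightarrow> convex A"
  by (auto simp: interval_cell_def)

lemma interval_cell_nonempty: "interval_cell A \<Longrightarrow> A \<noteq> {}"
  by (auto simp: interval_cell_def)

lemma interval_cell_poly:
  assumes "interval_cell A"
  shows "\<exists>f g. \<forall>x. x \<in> A \<longleftrightarrow> poly f x = 0 \<and> poly g x > 0"
proof -
  consider a where "A = {a}" | a b where "a < b" "A = {a<..<b}"
    using assms by (auto simp: interval_cell_def)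
  then show ?thesis
  proof cases
    case 1
    then show ?thesis by (intro exI[of _ "[:-a, 1:]"] exI[of _ 1]) auto
  next
    case 2
    have "poly ([:-a, 1:] * [:b, -1:]) x = (x - a) * (b - x)" for x
      unfolding poly_mult by simp
    then have "\<forall>x. x \<in> A \<longleftrightarrow> poly 0 x = 0 \<and> poly ([:-a, 1:] * [:b, -1:]) x > 0"
      using 2 by (simp add: zero_less_mult_iff del: mult_pCons_left mult_pCons_right) linarith
    then show ?thesis by blast
  qed
qed

lemma semialgebraic_zero_set_Int_box:
  assumes "interval_cell A" "interval_cell B"
  shows "semialgebraic ({z. ev P z = 0} \<inter> A \<times> B)"
proof -
  obtain f g f' g' where A: "\<And>x. x \<in> A \<longleftrightarrow> poly f x = 0 \<and> poly g x > 0"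
    and B: "\<And>x. x \<in> B \<longleftrightarrow> poly f' x = 0 \<and> poly g' x > 0"
    using interval_cell_poly assms by metis
  define lift where "lift = map_poly (\<lambda>c :: real. [:c:])"
  have lift: "ev (lift h) z = poly h (snd z)" for h z
    unfolding lift_def by (induction h) (simp_all add: map_poly_pCons ev_pCons)
  \<comment> \<open>Three conditions, for \<open>P\<close>, for \<open>A\<close> and for
    \<open>B\<close>; the constant 1 in \<open>G\<close> makes the inequality that goes with
    \<open>P\<close> trivial.\<close>
  define F where "F j = (if j = 0 then P else if j = 1 then [:f:] else lift f')" for j :: nat
  define G where "G j = (if j = 0 then 1 else if j = 1 then [:g:] else lift g')" for j :: nat
  have "{z. ev P z = 0} \<inter> A \<times> B = (\<Union>i<(1::nat). \<Inter>j<(3::nat). {z. ev (F j) z = 0 \<and> ev (G j) z > 0})"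
  proof (intro set_eqI iffI)
    fix z assume "z \<in> {z. ev P z = 0} \<inter> A \<times> B"
    then show "z \<in> (\<Union>i<(1::nat). \<Inter>j<(3::nat). {z. ev (F j) z = 0 \<and> ev (G j) z > 0})"
      by (auto simp: F_def G_def lift A B)
  next
    fix z assume "z \<in> (\<Union>i<(1::nat). \<Inter>j<(3::nat). {z. ev (F j) z = 0 \<and> ev (G j) z > 0})"
    then have "\<forall>j<3. ev (F j) z = 0 \<and> ev (G j) z > 0"
      unfolding UN_iff INT_iff lessThan_iff mem_Collect_eq by blast
    from spec[OF this, of 0] spec[OF this, of 1] spec[OF this, of 2]
    show "z \<in> {z. ev P z = 0} \<inter> A \<times> B"
      by (simp add: F_def G_def lift A B mem_Times_iff)
  qed
  then show ?thesis
    unfolding semialgebraic_def using poly2_ev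
    by (rule_tac exI[of _ 1], rule_tac exI[of _ 3], rule_tac exI[of _ "\<lambda>_ j. ev (F j)"],
        rule_tac exI[of _ "\<lambda>_ j. ev (G j)"]) blast
qed

lemma semialgebraic_box:
  assumes "interval_cell A" "interval_cell B"
  shows "semialgebraic (A \<times> B)"
  using semialgebraic_zero_set_Int_box[OF assms, of 0] by simp

lemma homeomorphic_open_interval:
  assumes "a < (b::real)"
  shows "{a<..<b} homeomorphic {0<..<(1::real)}"
  using assms homeomorphic_open_interval_UNIV[of a b] homeomorphic_open_interval_UNIV[of 0 "1::real"]
  by (metis homeomorphic_sym homeomorphic_trans zero_less_one)

lemma one_cell_graph:
  assumes "a < b" "continuous_on {a<..<b} f"
  shows "one_cell ((\<lambda>x. (x, f x)) ` {a<..<b})"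
proof -
  have "(\<lambda>x. (x, f x)) ` {a<..<b} homeomorphic {a<..<b}"
    by (rule homeomorphicI[of fst _ _ "\<lambda>x. (x, f x)"]) (auto intro!: continuous_intros assms simp: image_image)
  then show ?thesis
    unfolding one_cell_def using homeomorphic_open_interval[OF assms(1)] homeomorphic_trans by blast
qed

lemma is_cell_box:
  assumes A: "interval_cell A" and B: "interval_cell B"
  shows "is_cell (A \<times> B)"
proof -
  consider (1) a b where "A = {a}" "B = {b}"
    | (2) a c d where "A = {a}" "c < d" "B = {c<..<d}"
    | (3) a b c where "a < b" "A = {a<..<b}" "B = {c}"
    | (4) a b c d where "a < b" "A = {a<..<b}" "c < d" "B = {c<..<d}"
    using A B by (auto simp: interval_cell_def)
  then have "(\<exists>p. A \<times> B = {p}) \<or> A \<times> B homeomorphic {0<..<(1::real)} \<or> A \<times> B homeomorphic ball (0::pt) 1"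
  proof cases
    case 1
    then show ?thesis by auto
  next
    case 2
    have "A \<times> B homeomorphic {c<..<d}"
      unfolding 2 by (rule homeomorphicI[of snd _ _ "Pair a"]) (auto intro!: continuous_intros)
    then show ?thesis using homeomorphic_open_interval[OF 2(2)] homeomorphic_trans by blast
  next
    case 3
    have "A \<times> B homeomorphic {a<..<b}"
      unfolding 3 by (rule homeomorphicI[of fst _ _ "\<lambda>x. (x, c)"]) (auto intro!: continuous_intros)
    then show ?thesis using homeomorphic_open_interval[OF 3(1)] homeomorphic_trans by blast
  next
    case 4
    have "A \<times> B = box (a, c) (b, d)" using 4 by (auto simp: box_def Basis_prod_def)
    moreover from this have "box (a, c) (b, d) \<noteq> {}" using 4 by (auto simp flip: \<open>A \<times> B = _\<close>)
    ultimately have "A \<times> B homeomorphic (UNIV :: pt set)" using homeomorphic_box_UNIV by metis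
    then show ?thesis
      using homeomorphic_ball01_UNIV homeomorphic_sym homeomorphic_trans by blast
  qed
  then show ?thesis unfolding is_cell_def using semialgebraic_box[OF A B] by blast
qed

section \<open>Dyadic squares and partitions\<close>

definition dyadic_square :: "nat \<Rightarrow> pt \<Rightarrow> pt set" where
  "dyadic_square n p = {q. \<lfloor>2 ^ n * fst q\<rfloor> = \<lfloor>2 ^ n * fst p\<rfloor> \<and> \<lfloor>2 ^ n * snd q\<rfloor> = \<lfloor>2 ^ n * snd p\<rfloor>}"

lemma dyadic_square_eq: "q \<in> dyadic_square n p \<Longrightarrow> dyadic_square n q = dyadic_square n p"
  by (auto simp: dyadic_square_def)

text \<open>The coarse floor is the integer quotient of the fine one by \<open>2 ^ (n - m)\<close>.
  This is what makes dyadic squares nested.\<close>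

lemma floor_two_power_mono:
  fixes x y :: real
  assumes "m \<le> n" "\<lfloor>2 ^ n * x\<rfloor> = \<lfloor>2 ^ n * y\<rfloor>"
  shows "\<lfloor>2 ^ m * x\<rfloor> = \<lfloor>2 ^ m * y\<rfloor>"
proof -
  have "\<lfloor>2 ^ m * x\<rfloor> = \<lfloor>2 ^ n * x\<rfloor> div 2 ^ (n - m)" for x :: real
  proof -
    have "\<lfloor>2 ^ n * x / of_int (2 ^ (n - m))\<rfloor> = \<lfloor>2 ^ n * x\<rfloor> div 2 ^ (n - m)"
      by (rule floor_divide_real_eq_div) simp
    moreover have "2 ^ n * x / of_int (2 ^ (n - m)) = 2 ^ m * x"
    proof -
      have "(2::real) ^ n = 2 ^ m * 2 ^ (n - m)" using assms(1) by (simp flip: power_add)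
      then show ?thesis by simp
    qed
    ultimately show ?thesis by simp
  qed
  then show ?thesis using assms(2) by simp
qed

lemma dyadic_square_mono:
  assumes "m \<le> n"
  shows "dyadic_square n p \<subseteq> dyadic_square m p"
  by (auto simp: dyadic_square_def intro: floor_two_power_mono[OF assms])

lemma dyadic_square_in_open:
  assumes "open U" "p \<in> U"
  shows "\<exists>n \<delta>. \<delta> > 0 \<and> (\<forall>z\<in>dyadic_square n p. ball z \<delta> \<subseteq> U)"
proof -
  obtain r where r: "r > 0" "ball p r \<subseteq> U" using assms open_contains_ball by meson
  \<comment> \<open>Each coordinate then varies by less than \<open>r / 4\<close>, so the square
    stays within \<open>r / 2\<close> of \<open>p\<close> and a margin of \<open>r / 2\<close>
    remains around each of its points.\<close>
  obtain n where n: "(1/2) ^ n < r / 4" using real_arch_pow_inv[of "r/4" "1/2"] r by auto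
  have close: "\<bar>x - y\<bar> < r / 4" if "\<lfloor>2 ^ n * x\<rfloor> = \<lfloor>2 ^ n * y\<rfloor>" for x y :: real
  proof -
    have "\<bar>2 ^ n * x - 2 ^ n * y\<bar> < 1" using that by linarith
    then have "2 ^ n * \<bar>x - y\<bar> < 1" by (simp add: abs_mult flip: right_diff_distrib)
    then have "\<bar>x - y\<bar> < (1/2) ^ n" by (simp add: field_simps power_one_over)
    then show ?thesis using n by simp
  qed
  have "ball z (r/2) \<subseteq> U" if z: "z \<in> dyadic_square n p" for z
  proof -
    have "dist z p \<le> \<bar>fst z - fst p\<bar> + \<bar>snd z - snd p\<bar>"
      unfolding dist_prod_def dist_real_def by (rule sqrt_sum_squares_le_sum) auto
    also have "\<dots> < r / 2" using close[of "fst z" "fst p"] close[of "snd z" "snd p"] z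
      by (simp add: dyadic_square_def)
    finally have "dist z p < r / 2" .
    then have "ball z (r/2) \<subseteq> ball p r"
      by (intro subsetI) (metis dist_commute dist_triangle_half_r mem_ball)
    then show ?thesis using r by blast
  qed
  then show ?thesis using r by (intro exI[of _ n] exI[of _ "r/2"]) auto
qed

text \<open>A dyadic interval is half-open; integrality of \<open>2 ^ n * u\<close> separates its
  left end point from its interior.\<close>

lemma interval_cell_floor:
  fixes x :: real
  shows "interval_cell {u. \<lfloor>2 ^ n * u\<rfloor> = \<lfloor>2 ^ n * x\<rfloor> \<and> (2 ^ n * u \<in> \<int> \<longleftrightarrow> 2 ^ n * x \<in> \<int>)}"
    (is "interval_cell ?A")
proof (cases "2 ^ n * x \<in> \<int>")
  case True
  have "u = x" if "u \<in> ?A" for u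
  proof -
    have "2 ^ n * u \<in> \<int>" using that True by simp
    then obtain k l where kl: "2 ^ n * u = of_int k" "2 ^ n * x = of_int l"
      using True by (elim Ints_cases)
    then have "k = l" using that by simp
    then have "2 ^ n * u = 2 ^ n * x" using kl by simp
    then show ?thesis by (subst (asm) mult_cancel_left) simp
  qed
  then have "?A = {x}" by auto
  then show ?thesis unfolding interval_cell_def by blast
next
  case False
  define k where "k = \<lfloor>2 ^ n * x\<rfloor>"
  have "u \<in> ?A \<longleftrightarrow> of_int k < 2 ^ n * u \<and> 2 ^ n * u < of_int k + 1" for u
  proof
    assume u: "u \<in> ?A"
    then have "2 ^ n * u \<notin> \<int>" using False by simp
    then have "2 ^ n * u \<noteq> of_int k" by auto
    moreover have "\<lfloor>2 ^ n * u\<rfloor> = k" using u by (simp add: k_def)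
    ultimately show "of_int k < 2 ^ n * u \<and> 2 ^ n * u < of_int k + 1" by linarith
  next
    assume u: "of_int k < 2 ^ n * u \<and> 2 ^ n * u < of_int k + 1"
    then have "\<lfloor>2 ^ n * u\<rfloor> = k" by linarith
    moreover have "2 ^ n * u \<notin> \<int>"
    proof
      assume "2 ^ n * u \<in> \<int>"
      then obtain m where "2 ^ n * u = of_int m" by (elim Ints_cases)
      with u have "k < m" "m < k + 1" by linarith+
      then show False by simp
    qed
    ultimately show "u \<in> ?A" using False by (simp add: k_def)
  qed
  then have "?A = {u. of_int k < 2 ^ n * u \<and> 2 ^ n * u < of_int k + 1}" by blast
  also have "\<dots> = {of_int k / 2 ^ n<..<(of_int k + 1) / 2 ^ n}" by (auto simp: field_simps)
  finally have "?A = {of_int k / 2 ^ n<..<(of_int k + 1) / 2 ^ n}" .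
  moreover have "real_of_int k / 2 ^ n < (of_int k + 1) / 2 ^ n" by (simp add: divide_strict_right_mono)
  ultimately show ?thesis unfolding interval_cell_def by blast
qed

text \<open>Each point takes the largest good dyadic square around it. By nesting, all points of
  \<open>S\<close> in that square make the same choice, so the chosen squares do not overlap on
  \<open>S\<close>.\<close>

lemma dyadic_partition:
  assumes good: "\<And>p. p \<in> S \<Longrightarrow> \<exists>n. good (dyadic_square n p)"
  obtains \<A> where "countable \<A>" "\<Union>\<A> = S" "\<And>e. e \<in> \<A> \<Longrightarrow> e \<noteq> {}"
    "\<And>e e'. e \<in> \<A> \<Longrightarrow> e' \<in> \<A> \<Longrightarrow> e \<noteq> e' \<Longrightarrow> e \<inter> e' = {}"
    "\<And>e. e \<in> \<A> \<Longrightarrow> \<exists>A B n p. interval_cell A \<and> interval_cell B \<and> good (dyadic_square n p) \<and>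
       A \<times> B \<subseteq> dyadic_square n p \<and> e = S \<inter> A \<times> B"
proof -
  define level where "level p = (LEAST n. good (dyadic_square n p))" for p
  have level_good: "good (dyadic_square (level p) p)" if "p \<in> S" for p
    unfolding level_def using good[OF that] by (rule LeastI_ex)
  have level_eq: "level q = level p" if p: "p \<in> S" and q: "q \<in> S" "q \<in> dyadic_square (level p) p" for p q
  proof -
    have same: "dyadic_square m q = dyadic_square m p" if "m \<le> level p" for m
      using q(2) dyadic_square_mono[OF that] dyadic_square_eq by blast
    have le: "level q \<le> level p"
      unfolding level_def[of q] using same[of "level p"] level_good[OF p] by (intro Least_le) simp
    moreover have "level p \<le> level q"
      unfolding level_def[of p] using same[OF le] level_good[OF q(1)] by (intro Least_le) simp
    ultimately show ?thesis by simp
  qed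
  \<comment> \<open>The key names the chosen square and the corner, edge or open part of it that
    holds \<open>p\<close>. Its type is countable, hence so is the partition.\<close>
  define key where "key p = (let n = level p in
     (n, \<lfloor>2 ^ n * fst p\<rfloor>, \<lfloor>2 ^ n * snd p\<rfloor>, 2 ^ n * fst p \<in> \<int>, 2 ^ n * snd p \<in> \<int>))" for p :: pt
  define \<A> where "\<A> = (\<lambda>k. {p \<in> S. key p = k}) ` key ` S"
  have box: "\<exists>A B n p. interval_cell A \<and> interval_cell B \<and> good (dyadic_square n p) \<and>
       A \<times> B \<subseteq> dyadic_square n p \<and> e = S \<inter> A \<times> B" if e: "e \<in> \<A>" for e
  proof -
    obtain p where p: "p \<in> S" "e = {q \<in> S. key q = key p}" using e by (auto simp: \<A>_def)
    let ?n = "level p"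
    let ?I = "\<lambda>x. {u. \<lfloor>2 ^ ?n * u\<rfloor> = \<lfloor>2 ^ ?n * x\<rfloor> \<and> (2 ^ ?n * u \<in> \<int> \<longleftrightarrow> 2 ^ ?n * x \<in> \<int>)}"
    have sub: "?I (fst p) \<times> ?I (snd p) \<subseteq> dyadic_square ?n p" by (auto simp: dyadic_square_def)
    have "key q = key p \<longleftrightarrow> q \<in> ?I (fst p) \<times> ?I (snd p)" if "q \<in> S" for q
    proof
      assume "key q = key p"
      then show "q \<in> ?I (fst p) \<times> ?I (snd p)" by (auto simp: key_def Let_def mem_Times_iff)
    next
      assume q: "q \<in> ?I (fst p) \<times> ?I (snd p)"
      then have "level q = ?n" using level_eq[OF p(1) that] sub by blast
      then show "key q = key p" using q by (simp add: key_def Let_def mem_Times_iff)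
    qed
    then have "e = S \<inter> ?I (fst p) \<times> ?I (snd p)" using p(2) by blast
    then show ?thesis using interval_cell_floor level_good[OF p(1)] sub by blast
  qed
  have "countable \<A>" unfolding \<A>_def by (rule countable_image) (rule countableI_type)
  moreover have "\<Union>\<A> = S" "\<And>e. e \<in> \<A> \<Longrightarrow> e \<noteq> {}"
    "\<And>e e'. e \<in> \<A> \<Longrightarrow> e' \<in> \<A> \<Longrightarrow> e \<noteq> e' \<Longrightarrow> e \<inter> e' = {}" by (auto simp: \<A>_def)
  ultimately show thesis using that box by blast
qed

text \<open>An injective function pulls a point back to a point and a constant one pulls
  \<open>B\<close> back to all of \<open>A\<close>. For a strictly monotone function and open
  intervals, the preimage is open, bounded and order-convex, so it is the open interval between its
  infimum and supremum.\<close>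

lemma regular_monotone_preimage:
  assumes f: "regular_monotone_on J f" "continuous_on J f" and A: "A \<subseteq> J" "interval_cell A"
    and B: "interval_cell B" and ne: "{x \<in> A. f x \<in> B} \<noteq> {}"
  shows "interval_cell {x \<in> A. f x \<in> B}"
proof -
  let ?I = "{x \<in> A. f x \<in> B}"
  consider (point) a where "A = {a}" | (const) "\<forall>x\<in>J. \<forall>y\<in>J. f x = f y"
    | (inj) b where "B = {b}" "inj_on f J"
    | (strict) a b c d where "a < b" "A = {a<..<b}" "B = {c<..<d}"
        "(\<forall>x\<in>J. \<forall>y\<in>J. x < y \<longrightarrow> f x < f y) \<or> (\<forall>x\<in>J. \<forall>y\<in>J. x < y \<longrightarrow> f x > f y)"
  proof -
    have "inj_on f J" if "(\<forall>x\<in>J. \<forall>y\<in>J. x < y \<longrightarrow> f x < f y) \<or> (\<forall>x\<in>J. \<forall>y\<in>J. x < y \<longrightarrow> f x > f y)"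
      using that by (intro linorder_inj_onI') (metis less_irrefl)
    note inj = this
    show thesis
    proof (cases "\<forall>x\<in>J. \<forall>y\<in>J. f x = f y")
      case True
      then show thesis by (rule that(2))
    next
      case False
      then have strict: "(\<forall>x\<in>J. \<forall>y\<in>J. x < y \<longrightarrow> f x < f y) \<or> (\<forall>x\<in>J. \<forall>y\<in>J. x < y \<longrightarrow> f x > f y)"
        using f(1) unfolding regular_monotone_on_def by blast
      from A(2) consider a where "A = {a}" | a b where "a < b" "A = {a<..<b}"
        unfolding interval_cell_def by blast
      then show thesis
      proof cases
        case 1
        then show thesis by (rule that(1))
      next
        case A: 2
        from B consider c where "B = {c}" | c d where "c < d" "B = {c<..<d}"
          unfolding interval_cell_def by blast
        then show thesis
        proof cases
          case 1
          then show thesis using inj[OF strict] by (rule that(3))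
        next
          case 2
          show thesis by (rule that(4)[OF A 2(2) strict])
        qed
      qed
    qed
  qed
  then show ?thesis
  proof cases
    case point
    then have "?I = {a}" using ne by auto
    then show ?thesis unfolding interval_cell_def by blast
  next
    case const
    obtain x where x: "x \<in> A" "f x \<in> B" using ne by blast
    have "f u \<in> B" if "u \<in> A" for u
    proof -
      have "f u = f x" using const A(1) that x(1) by blast
      then show ?thesis using x(2) by simp
    qed
    then have "?I = A" by blast
    then show ?thesis using A by simp
  next
    case inj
    obtain x where x: "x \<in> ?I" using ne by blast
    then have "?I = {x}" using inj A(1) by (auto dest: inj_onD)
    then show ?thesis unfolding interval_cell_def by blast
  next
    case strict
    have conv: "y \<in> ?I" if xy: "x \<in> ?I" "z \<in> ?I" "x < y" "y < z" for x y z
    proof -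
      have "x \<in> A" "z \<in> A" using xy by auto
      then have y: "y \<in> A" using xy strict(2) by auto
      then have "x \<in> J" "y \<in> J" "z \<in> J" using xy A(1) by auto
      then have "f x < f y \<and> f y < f z \<or> f x > f y \<and> f y > f z" using strict(4) xy by blast
      moreover have "f x \<in> B" "f z \<in> B" using xy by auto
      ultimately have "f y \<in> B" unfolding strict(3) by auto
      then show ?thesis using y by auto
    qed
    have "open ?I"
      using continuous_open_preimage[of A f B] continuous_on_subset[OF f(2) A(1)] strict
      by (simp add: vimage_def Int_def)
    have bd: "bdd_below ?I" "bdd_above ?I" unfolding strict(2) by (auto intro: bdd_belowI[of _ a] bdd_aboveI[of _ b])
    have "?I = {Inf ?I<..<Sup ?I}"
    proof (intro set_eqI iffI)
      fix x assume "x \<in> {Inf ?I<..<Sup ?I}"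
      then obtain y z where "y \<in> ?I" "y < x" "z \<in> ?I" "x < z"
        using cInf_less_iff[OF ne bd(1)] less_cSup_iff[OF ne bd(2)] by auto
      then show "x \<in> ?I" using conv by blast
    next
      fix x assume "x \<in> ?I"
      then obtain e where e: "e > 0" "ball x e \<subseteq> ?I" using \<open>open ?I\<close> open_contains_ball by meson
      have "x - e/2 \<in> ball x e" "x + e/2 \<in> ball x e" using e(1) by (auto simp: dist_real_def)
      then have "Inf ?I \<le> x - e/2" "x + e/2 \<le> Sup ?I"
        using cInf_lower[OF subsetD[OF e(2)] bd(1)] cSup_upper[OF subsetD[OF e(2)] bd(2)] by blast+
      then show "x \<in> {Inf ?I<..<Sup ?I}" using e by auto
    qed
    moreover from this have "Inf ?I < Sup ?I" using ne by (metis (no_types, lifting) greaterThanLessThan_empty_iff not_le)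
    ultimately show ?thesis unfolding interval_cell_def by blast
  qed
qed

section \<open>Local structure and the decomposition\<close>

lemma open_ev_sgn: "open {w. ev q w * c > 0}"
  by (intro open_Collect_less continuous_intros continuous_on_ev)

lemma sgn_eq_of_mult_pos: "(x::real) * y > 0 \<Longrightarrow> sgn x = sgn y"
  by (auto simp: zero_less_mult_iff sgn_if)

text \<open>Either \<open>q\<close> vanishes wherever \<open>P\<close> does, or it keeps its sign at
  \<open>z\<close> by continuity.\<close>

lemma local_sgn_ev:
  assumes "P dvd q \<or> ev q z \<noteq> 0"
  obtains N s where "open N" "z \<in> N" "\<And>w. w \<in> N \<Longrightarrow> ev P w = 0 \<Longrightarrow> sgn (ev q w) = s"
proof (cases "P dvd q")
  case True
  then show thesis using that[of UNIV 0] by (simp add: ev_dvd)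
next
  case False
  then have "ev q z * ev q z > 0" using assms by (auto simp: zero_less_mult_iff)
  then show thesis
    by (intro that[of "{w. ev q w * ev q z > 0}" "sgn (ev q z)"] open_ev_sgn)
       (auto intro: sgn_eq_of_mult_pos)
qed

text \<open>Near \<open>z\<close> the signs of the y-derivative, the x-derivative and
  \<open>hess P\<close> are constant along the zero set, so f' and f'' have constant signs. The
  value of \<open>\<sigma>\<close> tells convex (1) from concave (-1).\<close>

lemma local_graph:
  assumes W: "open W" "z \<in> W" and P: "ev P z = 0" "ev (pderiv P) z \<noteq> 0"
    and dx: "P dvd dx P \<or> ev (dx P) z \<noteq> 0" and hess: "P dvd hess P \<or> ev (hess P) z \<noteq> 0"
  obtains a b c d f \<sigma> where "z \<in> {a<..<b} \<times> {c<..<d}" "{a<..<b} \<times> {c<..<d} \<subseteq> W"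
    "\<And>x. x \<in> {a<..<b} \<Longrightarrow> f x \<in> {c<..<d}"
    "\<And>x y. x \<in> {a<..<b} \<Longrightarrow> y \<in> {c<..<d} \<Longrightarrow> ev P (x, y) = 0 \<longleftrightarrow> y = f x"
    "continuous_on {a<..<b} f" "regular_monotone_on {a<..<b} f"
    "\<sigma> = 1 \<or> \<sigma> = -1" "convex_on {a<..<b} (\<lambda>x. \<sigma> * f x)"
proof -
  obtain N1 s1 where N1: "open N1" "z \<in> N1" "\<And>w. w \<in> N1 \<Longrightarrow> ev P w = 0 \<Longrightarrow> sgn (ev (dx P) w) = s1"
    by (rule local_sgn_ev[OF dx]) blast
  obtain N2 s2 where N2: "open N2" "z \<in> N2" "\<And>w. w \<in> N2 \<Longrightarrow> ev P w = 0 \<Longrightarrow> sgn (ev (hess P) w) = s2"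
    by (rule local_sgn_ev[OF hess]) blast
  obtain N3 s3 where N3: "open N3" "z \<in> N3" "\<And>w. w \<in> N3 \<Longrightarrow> ev P w = 0 \<Longrightarrow> sgn (ev (pderiv P) w) = s3"
    by (rule local_sgn_ev[of P "pderiv P" z]) (use P in blast)+
  have "s3 \<noteq> 0" using N3(3)[OF N3(2) P(1)] P(2) by (auto simp: sgn_eq_0_iff)
  have N: "open (W \<inter> N1 \<inter> N2 \<inter> N3)" "z \<in> W \<inter> N1 \<inter> N2 \<inter> N3"
    using W N1 N2 N3 by auto
  obtain a b c d f where z: "z \<in> {a<..<b} \<times> {c<..<d}"
    and box: "{a<..<b} \<times> {c<..<d} \<subseteq> W \<inter> N1 \<inter> N2 \<inter> N3"
    and f: "\<forall>x\<in>{a<..<b}. f x \<in> {c<..<d} \<and> (\<forall>y\<in>{c<..<d}. ev P (x, y) = 0 \<longleftrightarrow> y = f x)"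
    and cont: "continuous_on {a<..<b} f"
    using implicit_function[OF N P] by (elim exE conjE) blast
  define f1 where "f1 x = - ev (dx P) (x, f x) / ev (pderiv P) (x, f x)" for x
  define f2 where "f2 x = - ev (hess P) (x, f x) / ev (pderiv P) (x, f x) ^ 3" for x
  have on: "ev P (x, f x) = 0" "(x, f x) \<in> N1 \<inter> N2 \<inter> N3" if "x \<in> {a<..<b}" for x
    using f box that by auto
  have nz: "ev (pderiv P) (x, f x) \<noteq> 0" if "x \<in> {a<..<b}" for x
    using N3(3)[of "(x, f x)"] on[OF that] \<open>s3 \<noteq> 0\<close> by auto
  have D1: "(f has_real_derivative f1 x) (at x)" if "x \<in> {a<..<b}" for x
    unfolding f1_def using on nz that cont by (intro DERIV_implicit[of "{a<..<b}"]) auto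
  have D2: "(f1 has_real_derivative f2 x) (at x)" if "x \<in> {a<..<b}" for x
    unfolding f1_def[abs_def] f2_def
    by (rule DERIV_implicit_second[OF D1[OF that, unfolded f1_def] nz[OF that]])
  have s1: "sgn (f1 x) = - s1 / s3" if "x \<in> {a<..<b}" for x
    using N1(3)[of "(x, f x)"] N3(3)[of "(x, f x)"] on[OF that] by (simp add: f1_def sgn_divide)
  have s2: "sgn (f2 x) = - s2 / s3 ^ 3" if "x \<in> {a<..<b}" for x
    using N2(3)[of "(x, f x)"] N3(3)[of "(x, f x)"] on[OF that] by (simp add: f2_def sgn_divide sgn_mult power3_eq_cube)
  have "regular_monotone_on {a<..<b} f"
  proof (rule regular_monotone_onI[OF D1])
    consider "- s1 / s3 > 0" | "- s1 / s3 < 0" | "- s1 / s3 = 0" by linarith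
    then show "(\<forall>x\<in>{a<..<b}. f1 x > 0) \<or> (\<forall>x\<in>{a<..<b}. f1 x < 0) \<or> (\<forall>x\<in>{a<..<b}. f1 x = 0)"
    proof cases
      case 1
      then show ?thesis using s1 by (metis sgn_greater)
    next
      case 2
      then show ?thesis using s1 by (metis sgn_less)
    next
      case 3
      then show ?thesis using s1 by (metis sgn_eq_0_iff)
    qed
  qed
  moreover define \<sigma> :: real where "\<sigma> = (if - s2 / s3 ^ 3 \<ge> 0 then 1 else -1)"
  have "convex_on {a<..<b} (\<lambda>x. \<sigma> * f x)"
  proof (rule f''_ge0_imp_convex[where f' = "\<lambda>x. \<sigma> * f1 x" and f'' = "\<lambda>x. \<sigma> * f2 x"])
    fix x assume x: "x \<in> {a<..<b}"
    show "((\<lambda>x. \<sigma> * f x) has_real_derivative \<sigma> * f1 x) (at x)"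
      "((\<lambda>x. \<sigma> * f1 x) has_real_derivative \<sigma> * f2 x) (at x)"
      using D1[OF x] D2[OF x] by (auto intro: DERIV_cmult)
    have "0 \<le> - s2 / s3 ^ 3 \<longleftrightarrow> 0 \<le> f2 x" using s2[OF x] by (metis zero_le_sgn_iff)
    then show "0 \<le> \<sigma> * f2 x" by (auto simp: \<sigma>_def)
  qed auto
  moreover have "\<sigma> = 1 \<or> \<sigma> = -1" by (simp add: \<sigma>_def)
  moreover have "{a<..<b} \<times> {c<..<d} \<subseteq> W" using box by blast
  ultimately show thesis using that[of a b c d f \<sigma>] z f cont by blast
qed

text \<open>The region is the image of a product with the unit interval under a map that is affine
  on each column.\<close>

lemma connected_between_graphs:
  fixes f g :: "real \<Rightarrow> real"
  assumes J: "connected J" and f: "continuous_on J f" "continuous_on J g"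
    and less: "\<And>x. x \<in> J \<Longrightarrow> f x < g x"
  shows "connected {w. fst w \<in> J \<and> f (fst w) < snd w \<and> snd w < g (fst w)}"
proof -
  let ?h = "\<lambda>w. (fst w, f (fst w) + snd w * (g (fst w) - f (fst w)))"
  have "{w. fst w \<in> J \<and> f (fst w) < snd w \<and> snd w < g (fst w)} = ?h ` (J \<times> {0<..<1})"
  proof (intro set_eqI iffI)
    fix w assume w: "w \<in> {w. fst w \<in> J \<and> f (fst w) < snd w \<and> snd w < g (fst w)}"
    define t where "t = (snd w - f (fst w)) / (g (fst w) - f (fst w))"
    have "g (fst w) - f (fst w) > 0" using w less by simp
    then have "t \<in> {0<..<1}" "w = ?h (fst w, t)" using w by (simp_all add: t_def prod_eq_iff)
    then show "w \<in> ?h ` (J \<times> {0<..<1})" using w by blast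
  next
    fix w assume "w \<in> ?h ` (J \<times> {0<..<1})"
    then obtain x t where w: "x \<in> J" "0 < t" "t < 1" "w = (x, f x + t * (g x - f x))" by auto
    have "t * (g x - f x) > 0" "t * (g x - f x) < 1 * (g x - f x)"
      using w less[OF w(1)] by (auto intro!: mult_strict_right_mono)
    then show "w \<in> {w. fst w \<in> J \<and> f (fst w) < snd w \<and> snd w < g (fst w)}" using w by simp
  qed
  moreover have "continuous_on (J \<times> {0<..<1}) ?h"
    by (intro continuous_intros continuous_on_compose2[OF f(1)] continuous_on_compose2[OF f(2)]) auto
  ultimately show ?thesis using connected_continuous_image connected_Times[OF J, of "{0<..<1::real}"] by fastforce
qed

text \<open>By monotonicity \<open>e\<close> is a point or the graph over an open interval. In the
  second case the two boundary lemmas apply, according to whether the convex side of the graph lies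
  in \<open>X\<close>.\<close>

lemma graph_piece:
  fixes f :: "real \<Rightarrow> real"
  assumes U: "U = {a<..<b} \<times> {c<..<d}"
    and f: "\<And>x. x \<in> {a<..<b} \<Longrightarrow> f x \<in> {c<..<d}"
    and cont: "continuous_on {a<..<b} f" and reg: "regular_monotone_on {a<..<b} f"
    and \<sigma>: "\<sigma> = 1 \<or> \<sigma> = -1" and conv: "convex_on {a<..<b} (\<lambda>x. \<sigma> * f x)"
    and graph: "{w \<in> U. snd w = f (fst w)} \<subseteq> X"
    and up: "{w \<in> U. f (fst w) < snd w} \<subseteq> X \<or> {w \<in> U. f (fst w) < snd w} \<inter> X = {}"
    and down: "{w \<in> U. snd w < f (fst w)} \<subseteq> X \<or> {w \<in> U. snd w < f (fst w)} \<inter> X = {}"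
    and AB: "interval_cell A" "interval_cell B"
    and \<delta>: "\<delta> > 0" "\<And>w. w \<in> A \<times> B \<Longrightarrow> ball w \<delta> \<subseteq> U"
    and e: "e = {w \<in> A \<times> B. snd w = f (fst w)}" "e \<noteq> {}"
  shows "((\<exists>p. e = {p}) \<or> one_cell e) \<and> tame_cell X e"
proof -
  have sub: "A \<times> B \<subseteq> U" using \<delta> by (auto simp: subset_iff)
  then have AJ: "A \<subseteq> {a<..<b}" using interval_cell_nonempty[OF AB(2)] unfolding U by auto
  define I where "I = {x \<in> A. f x \<in> B}"
  have eI: "e = (\<lambda>x. (x, f x)) ` I" using e(1) by (auto simp: I_def)
  then have "I \<noteq> {}" using e(2) by blast
  then have "interval_cell I"
    unfolding I_def by (intro regular_monotone_preimage[OF reg cont AJ AB]) auto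
  then consider x where "I = {x}" | u v where "u < v" "I = {u<..<v}"
    unfolding interval_cell_def by blast
  then show ?thesis
  proof cases
    case 1
    then have p: "e = {(x, f x)}" using eI by simp
    have "(x, f x) \<in> A \<times> B" using 1 by (auto simp: I_def)
    then have "(x, f x) \<in> X" using graph sub by auto
    then have "tame_cell X e" unfolding p by (intro tame_convex) auto
    then show ?thesis using p by blast
  next
    case 2
    have I: "I \<subseteq> {a<..<b}" using AJ by (auto simp: I_def)
    then have one: "one_cell e"
      unfolding eI 2(2) by (intro one_cell_graph[OF 2(1)] continuous_on_subset[OF cont]) (simp add: 2)
    \<comment> \<open>A convex function plus a linear one, vanishing exactly on the graph. The
      convex side \<open>\<phi>\<close> < 0 is above the graph for \<open>\<sigma>\<close> = 1 and
      below it for \<open>\<sigma>\<close> = -1.\<close>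
    define \<phi> where "\<phi> w = \<sigma> * f (fst w) - \<sigma> * snd w" for w :: pt
    have \<phi>0: "\<phi> w = 0 \<longleftrightarrow> snd w = f (fst w)" for w using \<sigma> by (auto simp: \<phi>_def)
    have "convex U" unfolding U by (intro convex_Times) auto
    have \<phi>conv: "convex_on U \<phi>"
    proof (rule convex_onI)
      fix t :: real and x y assume t: "0 < t" "t < 1" and xy: "x \<in> U" "y \<in> U"
      have "\<sigma> * f ((1 - t) *\<^sub>R fst x + t *\<^sub>R fst y) \<le> (1 - t) * (\<sigma> * f (fst x)) + t * (\<sigma> * f (fst y))"
        by (rule convex_onD[OF conv]) (use t xy U in auto)
      then show "\<phi> ((1 - t) *\<^sub>R x + t *\<^sub>R y) \<le> (1 - t) * \<phi> x + t * \<phi> y"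
        by (simp add: \<phi>_def algebra_simps)
    qed fact
    have \<phi>cont: "continuous_on U \<phi>"
      unfolding \<phi>_def by (intro continuous_intros continuous_on_compose2[OF cont]) (auto simp: U)
    have neg: "{w \<in> U. \<phi> w < 0} \<subseteq> X \<or> {w \<in> U. \<phi> w < 0} \<inter> X = {}"
      and pos: "{w \<in> U. \<phi> w > 0} \<subseteq> X \<or> {w \<in> U. \<phi> w > 0} \<inter> X = {}"
      using \<sigma> up down by (auto simp: \<phi>_def)
    from neg have "tame_cell X e"
    proof
      assume "{w \<in> U. \<phi> w < 0} \<subseteq> X"
      then have "{w \<in> U. \<phi> w \<le> 0} \<subseteq> X" using graph \<phi>0 by (auto simp: le_less)
      then show ?thesis
      proof (rule tame_sublevel_boundary[OF one \<phi>conv])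
        show "convex (A \<times> B)" using AB by (intro convex_Times interval_cell_convex)
        show "e = {p \<in> A \<times> B. \<phi> p = 0}" using e(1) \<phi>0 by simp
      qed fact
    next
      assume off: "{w \<in> U. \<phi> w < 0} \<inter> X = {}"
      show ?thesis
      proof (rule tame_superlevel_boundary[OF one _ \<phi>conv \<phi>cont _ pos \<delta>(1),
            where E = "{p \<in> U. \<phi> p = 0}" and \<pi> = fst and \<rho> = "\<lambda>x. (x, f x)"])
        show "open U" unfolding U by (intro open_Times) auto
        show "0 \<le> \<phi> p" if "p \<in> X" "p \<in> U" for p using off that by (auto simp: not_less[symmetric])
        show "ball z \<delta> \<subseteq> U" if "z \<in> e" for z using \<delta>(2) that e(1) by blast
        show "e \<subseteq> {p \<in> U. \<phi> p = 0}" using e(1) sub \<phi>0 by blast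
        show "continuous_on (fst ` {p \<in> U. \<phi> p = 0}) (\<lambda>x. (x, f x))"
          by (intro continuous_intros continuous_on_subset[OF cont]) (auto simp: U)
        show "(fst p, f (fst p)) = p" if "p \<in> {p \<in> U. \<phi> p = 0}" for p
          using that \<phi>0 by (simp add: prod_eq_iff)
        have "fst ` e = I" unfolding eI by (force simp: image_image)
        then show "connected (fst ` e)" using 2 by simp
      qed (auto intro: continuous_intros)
    qed
    then show ?thesis using one by blast
  qed
qed

text \<open>All that remains of semialgebraicity: membership in \<open>X\<close> is decided by the
  signs of finitely many nonzero polynomials.\<close>

locale sign_invariant_set =
  fixes FF :: "real poly poly set" and X :: "pt set"
  assumes finite_FF: "finite FF" and nonzero_FF: "0 \<notin> FF"
    and mem_cong: "\<And>z w. (\<And>q. q \<in> FF \<Longrightarrow> sgn (ev q z) = sgn (ev q w)) \<Longrightarrow> z \<in> X \<longleftrightarrow> w \<in> X"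
begin

section \<open>The zero set and its exceptional points\<close>

definition zeros :: "pt set" where "zeros = {z. \<exists>q\<in>FF. ev q z = 0}"

lemma closed_zeros: "closed zeros"
proof -
  have "closed {z. ev q z = 0}" for q
    by (intro closed_Collect_eq continuous_on_ev continuous_intros)
  moreover have "zeros = (\<Union>q\<in>FF. {z. ev q z = 0})" by (auto simp: zeros_def)
  ultimately show ?thesis using finite_FF by auto
qed

text \<open>By the intermediate value theorem no polynomial in \<open>FF\<close> changes sign on
  \<open>C\<close>, so all points of \<open>C\<close> have the same signs.\<close>

lemma connected_dichotomy:
  assumes C: "connected C" "C \<inter> zeros = {}"
  shows "C \<subseteq> X \<or> C \<inter> X = {}"
proof -
  have "sgn (ev q z) = sgn (ev q w)" if q: "q \<in> FF" and zw: "z \<in> C" "w \<in> C" for q z w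
  proof (rule ccontr)
    assume ne: "sgn (ev q z) \<noteq> sgn (ev q w)"
    have nz: "ev q u \<noteq> 0" if "u \<in> C" for u using C(2) q that by (auto simp: zeros_def)
    have "connected (ev q ` C)" using C(1) continuous_on_ev by (rule connected_continuous_image[rotated])
    then have iv: "is_interval (ev q ` C)" by (simp add: is_interval_connected_1)
    have "0 \<in> ev q ` C"
    proof (cases "ev q z < 0")
      case True
      then have "ev q w > 0" using ne nz[OF zw(2)] by (auto simp: sgn_if split: if_splits)
      with True show ?thesis
        using iv zw unfolding is_interval_1 by (meson imageI less_imp_le)
    next
      case False
      then have "ev q z > 0" "ev q w < 0"
        using ne nz[OF zw(1)] nz[OF zw(2)] by (auto simp: sgn_if split: if_splits)
      then show ?thesis
        using iv zw unfolding is_interval_1 by (meson imageI less_imp_le)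
    qed
    then show False using nz by auto
  qed
  then have "z \<in> X \<longleftrightarrow> w \<in> X" if "z \<in> C" "w \<in> C" for z w
    using mem_cong that by blast
  then show ?thesis by blast
qed

lemma open_off_zeros: "open (X - zeros)"
  unfolding open_contains_ball
proof
  fix z assume z: "z \<in> X - zeros"
  then obtain r where r: "r > 0" "ball z r \<subseteq> - zeros"
    using closed_zeros open_contains_ball[of "- zeros"] by (auto simp: open_Compl)
  then have "ball z r \<subseteq> X \<or> ball z r \<inter> X = {}" by (intro connected_dichotomy) auto
  moreover have "z \<in> ball z r \<inter> X" using r z by simp
  ultimately have "ball z r \<subseteq> X" by blast
  then show "\<exists>e>0. ball z e \<subseteq> X - zeros" using r z by (intro exI[of _ r]) auto
qed

definition factors :: "real poly poly set" where
  "factors = (\<Union>q\<in>FF. prime_factors q)"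

text \<open>Crossings of two factors, singular points and vertical tangents
  (\<open>pderiv P\<close>), horizontal tangents (\<open>dx P\<close>) and inflections
  (\<open>hess P\<close>). Polynomials divisible by \<open>P\<close> vanish on its whole zero set,
  as \<open>hess P\<close> does for a line; leaving them out keeps the set finite.\<close>

definition exceptional :: "pt set" where
  "exceptional = (\<Union>P\<in>factors. \<Union>q\<in>{q \<in> FF \<union> factors \<union> {pderiv P, dx P, hess P}. \<not> P dvd q}.
     {z. ev P z = 0 \<and> ev q z = 0})"

lemma finite_factors: "finite factors"
  using finite_FF by (simp add: factors_def)

lemma prime_factors_prime: "P \<in> factors \<Longrightarrow> prime P"
  by (auto simp: factors_def)

lemma finite_exceptional: "finite exceptional"
  unfolding exceptional_def
proof (intro finite_UN_I finite_factors)
  fix P q assume P: "P \<in> factors"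
  show "finite {q \<in> FF \<union> factors \<union> {pderiv P, dx P, hess P}. \<not> P dvd q}"
    using finite_FF finite_factors by auto
  assume "q \<in> {q \<in> FF \<union> factors \<union> {pderiv P, dx P, hess P}. \<not> P dvd q}"
  then show "finite {z. ev P z = 0 \<and> ev q z = 0}"
    using finite_common_zeros P prime_factors_prime by (auto intro: prime_imp_prime_elem)
qed

lemma factor_zero:
  assumes "q \<in> FF" "ev q z = 0"
  shows "\<exists>P\<in>factors. P dvd q \<and> ev P z = 0"
proof -
  have q: "q \<noteq> 0" using assms nonzero_FF by auto
  then have "q dvd prod_mset (prime_factorization q)"
    by (intro associatedD1) (simp add: prod_mset_prime_factorization_weak)
  then have 0: "ev (prod_mset (prime_factorization q)) z = 0" using assms(2) by (rule ev_dvd)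
  have "\<exists>P\<in>#M. ev P z = 0" if "ev (prod_mset M) z = 0" for M
    using that by (induction M) auto
  from this[OF 0] obtain P where "P \<in> prime_factors q" "ev P z = 0" by blast
  then show ?thesis using assms(1) by (auto simp: factors_def)
qed

text \<open>Near \<open>z\<close> all polynomials of \<open>FF\<close> and all factors not divisible
  by \<open>P\<close> keep their nonzero signs. So no other factor vanishes there, and zeros of
  \<open>P\<close> have the same signs as \<open>z\<close>, which lies in \<open>X\<close>.\<close>

lemma local_zeros:
  assumes z: "z \<in> X" "z \<in> zeros" "z \<notin> exceptional"
  obtains P W where "P \<in> factors" "ev P z = 0" "open W" "z \<in> W"
    "\<And>w. w \<in> W \<Longrightarrow> w \<in> zeros \<longleftrightarrow> ev P w = 0" "\<And>w. w \<in> W \<Longrightarrow> ev P w = 0 \<Longrightarrow> w \<in> X"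
    "\<And>q. q \<in> {pderiv P, dx P, hess P} \<Longrightarrow> P dvd q \<or> ev q z \<noteq> 0"
proof -
  obtain q0 P where P: "P \<in> factors" "ev P z = 0" "q0 \<in> FF" "P dvd q0"
    using z(2) factor_zero unfolding zeros_def by blast
  have nz: "ev q z \<noteq> 0" if "q \<in> FF \<union> factors \<union> {pderiv P, dx P, hess P}" "\<not> P dvd q" for q
    using z(3) P that unfolding exceptional_def by blast
  define K where "K = {q \<in> FF \<union> factors. \<not> P dvd q}"
  define W where "W = (\<Inter>q\<in>K. {w. ev q w * ev q z > 0})"
  have "finite K" using finite_FF finite_factors by (simp add: K_def)
  then have "open W" unfolding W_def by (intro open_INT) (auto simp: open_ev_sgn)
  moreover have "ev q z * ev q z > 0" if "q \<in> K" for q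
  proof -
    have "ev q z \<noteq> 0" using that nz[of q] by (auto simp: K_def)
    then show ?thesis by (metis not_real_square_gt_zero)
  qed
  then have "z \<in> W" by (simp add: W_def)
  moreover have "w \<in> zeros \<longleftrightarrow> ev P w = 0" if w: "w \<in> W" for w
  proof
    assume "w \<in> zeros"
    then obtain P' where P': "P' \<in> factors" "ev P' w = 0" unfolding zeros_def using factor_zero by blast
    have "P' \<notin> K"
    proof
      assume "P' \<in> K"
      then have "ev P' w * ev P' z > 0" using w by (auto simp: W_def)
      with P' show False by simp
    qed
    then have "P dvd P'" using P' by (auto simp: K_def)
    \<comment> \<open>The predicate \<open>prime\<close> includes normalization, so that
      divisibility between two primes is equality and not mere association.\<close>
    then have "P = P'"
      by (rule primes_dvd_imp_eq[OF prime_factors_prime[OF P(1)] prime_factors_prime[OF P'(1)]])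
    then show "ev P w = 0" using P' by simp
  next
    assume "ev P w = 0"
    then show "w \<in> zeros" using P ev_dvd unfolding zeros_def by blast
  qed
  moreover have "w \<in> X" if w: "w \<in> W" "ev P w = 0" for w
  proof -
    have "sgn (ev q z) = sgn (ev q w)" if q: "q \<in> FF" for q
    proof (cases "P dvd q")
      case True
      then show ?thesis using ev_dvd P w by metis
    next
      case False
      then have "ev q w * ev q z > 0" using w(1) q by (auto simp: W_def K_def)
      then show ?thesis using sgn_eq_of_mult_pos by metis
    qed
    then show ?thesis using mem_cong z(1) by blast
  qed
  ultimately show thesis using that[of P W] P nz by blast
qed

text \<open>If \<open>P\<close> is free of y, the piece lies on one vertical line and is convex.
  Otherwise \<open>P\<close> does not divide its y-derivative, so the latter is nonzero at
  \<open>z\<close> and the zero set is locally a graph.\<close>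

lemma piece_cells:
  assumes z: "z \<in> X" "z \<in> zeros" "z \<notin> exceptional"
  obtains U where "open U" "z \<in> U"
    "\<And>A B \<delta>. \<lbrakk>interval_cell A; interval_cell B; \<delta> > 0; \<And>w. w \<in> A \<times> B \<Longrightarrow> ball w \<delta> \<subseteq> U;
       X \<inter> zeros \<inter> A \<times> B \<noteq> {}\<rbrakk> \<Longrightarrow>
     is_cell (X \<inter> zeros \<inter> A \<times> B) \<and> tame_cell X (X \<inter> zeros \<inter> A \<times> B)"
proof -
  obtain P W where P: "P \<in> factors" "ev P z = 0" and W: "open W" "z \<in> W"
    and zW: "\<And>w. w \<in> W \<Longrightarrow> w \<in> zeros \<longleftrightarrow> ev P w = 0"
    and XW: "\<And>w. w \<in> W \<Longrightarrow> ev P w = 0 \<Longrightarrow> w \<in> X"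
    and reg: "\<And>q. q \<in> {pderiv P, dx P, hess P} \<Longrightarrow> P dvd q \<or> ev q z \<noteq> 0"
    using local_zeros[OF z] by blast
  have prime: "prime P" using P prime_factors_prime by blast
  show thesis
  proof (cases "degree P = 0")
    case True
    then obtain p where p: "P = [:p:]" by (rule degree_eq_zeroE)
    have "p \<noteq> 0" using prime p by auto
    \<comment> \<open>Removing the other roots of \<open>p\<close> leaves only the vertical line
      through \<open>z\<close>.\<close>
    define U where "U = W \<inter> fst -` (- ({x. poly p x = 0} - {fst z}))"
    have "open (- ({x. poly p x = 0} - {fst z}))"
      using poly_roots_finite[OF \<open>p \<noteq> 0\<close>] by (intro open_Compl finite_imp_closed) auto
    then have "open U" unfolding U_def using W by (intro open_Int open_vimage_fst)
    moreover have "z \<in> U" using W by (simp add: U_def)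
    moreover have "is_cell (X \<inter> zeros \<inter> A \<times> B) \<and> tame_cell X (X \<inter> zeros \<inter> A \<times> B)"
      if A: "interval_cell A" and B: "interval_cell B" and "\<delta> > 0" and \<delta>: "\<And>w. w \<in> A \<times> B \<Longrightarrow> ball w \<delta> \<subseteq> U"
        and ne: "X \<inter> zeros \<inter> A \<times> B \<noteq> {}" for A B \<delta>
    proof -
      have sub: "A \<times> B \<subseteq> U" using \<delta> \<open>\<delta> > 0\<close> centre_in_ball by blast
      have *: "w \<in> X \<inter> zeros \<longleftrightarrow> fst w = fst z" if "w \<in> A \<times> B" for w
      proof -
        have "w \<in> U" using that sub by blast
        then show ?thesis using zW[of w] XW[of w] P(2) by (auto simp: U_def p)
      qed
      then have "fst z \<in> A" using ne by force
      then have eq: "X \<inter> zeros \<inter> A \<times> B = {fst z} \<times> B"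
      proof (intro set_eqI iffI)
        fix w assume w: "w \<in> {fst z} \<times> B"
        then have "w \<in> A \<times> B" using \<open>fst z \<in> A\<close> by auto
        then show "w \<in> X \<inter> zeros \<inter> A \<times> B" using *[of w] w by auto
      next
        fix w assume w: "w \<in> X \<inter> zeros \<inter> A \<times> B"
        then show "w \<in> {fst z} \<times> B" using *[of w] by (auto simp: mem_Times_iff)
      qed
      have cell: "interval_cell {fst z}" unfolding interval_cell_def by blast
      have "is_cell ({fst z} \<times> B)" by (rule is_cell_box[OF cell B])
      moreover have "convex ({fst z} \<times> B)" by (intro convex_Times interval_cell_convex cell B)
      then have "tame_cell X ({fst z} \<times> B)" using eq by (intro tame_convex) auto
      ultimately show ?thesis using eq by simp
    qed
    ultimately show thesis by (rule that)
  next
    case False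
    have "\<not> P dvd pderiv P"
    proof
      assume "P dvd pderiv P"
      moreover have "pderiv P \<noteq> 0" using False by (simp add: pderiv_eq_0_iff)
      ultimately have "degree P \<le> degree (pderiv P)" by (rule dvd_imp_degree_le)
      then show False using False by (simp add: degree_pderiv)
    qed
    then have nz: "ev (pderiv P) z \<noteq> 0" "P dvd dx P \<or> ev (dx P) z \<noteq> 0" "P dvd hess P \<or> ev (hess P) z \<noteq> 0"
      using reg by blast+
    obtain a b c d f \<sigma> where zbox: "z \<in> {a<..<b} \<times> {c<..<d}" and box: "{a<..<b} \<times> {c<..<d} \<subseteq> W"
      and f: "\<And>x. x \<in> {a<..<b} \<Longrightarrow> f x \<in> {c<..<d}"
        "\<And>x y. x \<in> {a<..<b} \<Longrightarrow> y \<in> {c<..<d} \<Longrightarrow> ev P (x, y) = 0 \<longleftrightarrow> y = f x"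
      and f': "continuous_on {a<..<b} f" "regular_monotone_on {a<..<b} f"
        "\<sigma> = 1 \<or> \<sigma> = -1" "convex_on {a<..<b} (\<lambda>x. \<sigma> * f x)"
      by (rule local_graph[OF W P(2) nz]) blast
    define U where "U = {a<..<b} \<times> {c<..<d}"
    have zU: "w \<in> zeros \<longleftrightarrow> snd w = f (fst w)" if "w \<in> U" for w
      using that box zW[of w] f(2)[of "fst w" "snd w"] by (auto simp: U_def)
    have graph: "{w \<in> U. snd w = f (fst w)} \<subseteq> X"
    proof
      fix w assume "w \<in> {w \<in> U. snd w = f (fst w)}"
      then have "w \<in> W" "w \<in> zeros" using box zU[of w] unfolding U_def by blast+
      then show "w \<in> X" using XW zW by blast
    qed
    have "{w \<in> U. f (fst w) < snd w} = {w. fst w \<in> {a<..<b} \<and> f (fst w) < snd w \<and> snd w < d}"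
      "{w \<in> U. snd w < f (fst w)} = {w. fst w \<in> {a<..<b} \<and> c < snd w \<and> snd w < f (fst w)}"
      using f(1) by (auto simp: U_def) (meson less_trans)+
    moreover have "connected {w. fst w \<in> {a<..<b} \<and> f (fst w) < snd w \<and> snd w < d}"
      "connected {w. fst w \<in> {a<..<b} \<and> c < snd w \<and> snd w < f (fst w)}"
      using f(1) by (intro connected_between_graphs f'(1) continuous_on_const; simp)+
    ultimately have sides: "connected {w \<in> U. f (fst w) < snd w}" "connected {w \<in> U. snd w < f (fst w)}"
      by simp_all
    have up: "{w \<in> U. f (fst w) < snd w} \<subseteq> X \<or> {w \<in> U. f (fst w) < snd w} \<inter> X = {}"
      using zU by (intro connected_dichotomy sides) auto
    have down: "{w \<in> U. snd w < f (fst w)} \<subseteq> X \<or> {w \<in> U. snd w < f (fst w)} \<inter> X = {}"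
      using zU by (intro connected_dichotomy sides) auto
    have "is_cell (X \<inter> zeros \<inter> A \<times> B) \<and> tame_cell X (X \<inter> zeros \<inter> A \<times> B)"
      if A: "interval_cell A" and B: "interval_cell B" and "\<delta> > 0" and \<delta>: "\<And>w. w \<in> A \<times> B \<Longrightarrow> ball w \<delta> \<subseteq> U"
        and ne: "X \<inter> zeros \<inter> A \<times> B \<noteq> {}" for A B \<delta>
    proof -
      have sub: "A \<times> B \<subseteq> U" using \<delta> \<open>\<delta> > 0\<close> centre_in_ball by blast
      then have eq: "X \<inter> zeros \<inter> A \<times> B = {w \<in> A \<times> B. snd w = f (fst w)}"
        using zU graph by blast
      have "((\<exists>p. X \<inter> zeros \<inter> A \<times> B = {p}) \<or> one_cell (X \<inter> zeros \<inter> A \<times> B)) \<and>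
          tame_cell X (X \<inter> zeros \<inter> A \<times> B)"
        using \<delta> ne by (intro graph_piece[OF U_def f(1) f' graph up down A B \<open>\<delta> > 0\<close> _ eq]) auto
      moreover have "X \<inter> zeros \<inter> A \<times> B = {w. ev P w = 0} \<inter> A \<times> B"
      proof -
        have "A \<times> B \<subseteq> W" using sub box unfolding U_def by blast
        then show ?thesis using zW XW by blast
      qed
      then have "semialgebraic (X \<inter> zeros \<inter> A \<times> B)"
        using semialgebraic_zero_set_Int_box[OF A B] by simp
      ultimately show ?thesis unfolding is_cell_def one_cell_def by blast
    qed
    moreover have "open U" unfolding U_def by (intro open_Times) auto
    moreover have "z \<in> U" using zbox by (simp add: U_def)
    ultimately show thesis using that[of U] by blast
  qed
qed

section \<open>Gluing open cells, pieces of the zero set and single points\<close>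

lemma exists_tame_partition:
  "\<exists>\<A>. countable \<A> \<and> \<Union>\<A> = X \<and> (\<forall>e\<in>\<A>. e \<noteq> {} \<and> is_cell e \<and> tame_cell X e) \<and>
     (\<forall>e\<in>\<A>. \<forall>e'\<in>\<A>. e \<noteq> e' \<longrightarrow> e \<inter> e' = {})"
proof -
  have "\<exists>n. dyadic_square n p \<subseteq> X - zeros" if "p \<in> X - zeros" for p
    using dyadic_square_in_open[OF open_off_zeros that] by (meson centre_in_ball subsetD subsetI)
  then obtain \<A>1 where A1: "countable \<A>1" "\<Union>\<A>1 = X - zeros" "\<And>e. e \<in> \<A>1 \<Longrightarrow> e \<noteq> {}"
      "\<And>e e'. e \<in> \<A>1 \<Longrightarrow> e' \<in> \<A>1 \<Longrightarrow> e \<noteq> e' \<Longrightarrow> e \<inter> e' = {}"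
      "\<And>e. e \<in> \<A>1 \<Longrightarrow> \<exists>A B n p. interval_cell A \<and> interval_cell B \<and> dyadic_square n p \<subseteq> X - zeros \<and>
       A \<times> B \<subseteq> dyadic_square n p \<and> e = (X - zeros) \<inter> A \<times> B"
    by (rule dyadic_partition[of "X - zeros" "\<lambda>Q. Q \<subseteq> X - zeros"]) blast+
  have cells1: "is_cell e \<and> tame_cell X e" if "e \<in> \<A>1" for e
  proof -
    obtain A B where AB: "interval_cell A" "interval_cell B" and sub: "A \<times> B \<subseteq> X - zeros" and "e = (X - zeros) \<inter> A \<times> B"
      using A1(5)[OF \<open>e \<in> \<A>1\<close>] by (elim exE conjE) (blast dest: subset_trans)
    then have e: "e = A \<times> B" by blast
    moreover have "convex (A \<times> B)" by (intro convex_Times interval_cell_convex AB)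
    ultimately show ?thesis using is_cell_box[OF AB] tame_convex[of "A \<times> B" X] sub by blast
  qed
  define good where "good Q \<longleftrightarrow> (\<forall>A B. interval_cell A \<and> interval_cell B \<and> A \<times> B \<subseteq> Q \<and>
      X \<inter> zeros \<inter> A \<times> B \<noteq> {} \<longrightarrow> is_cell (X \<inter> zeros \<inter> A \<times> B) \<and> tame_cell X (X \<inter> zeros \<inter> A \<times> B))" for Q
  \<comment> \<open>Defining \<open>S\<close> by the existence of a good square, not as the
    complement of \<open>exceptional\<close>, ensures that a good square contains no point of
    \<open>X \<inter> zeros\<close> outside \<open>S\<close>. The pieces of \<open>S\<close> are
    then exactly the sets that \<open>good\<close> speaks of, and the leftover points are among the
    finitely many exceptional ones.\<close>
  define S where "S = {p \<in> X \<inter> zeros. \<exists>n. good (dyadic_square n p)}"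
  have "\<exists>n. good (dyadic_square n p)" if "p \<in> S" for p using that by (simp add: S_def)
  then obtain \<A>2 where A2: "countable \<A>2" "\<Union>\<A>2 = S" "\<And>e. e \<in> \<A>2 \<Longrightarrow> e \<noteq> {}"
      "\<And>e e'. e \<in> \<A>2 \<Longrightarrow> e' \<in> \<A>2 \<Longrightarrow> e \<noteq> e' \<Longrightarrow> e \<inter> e' = {}"
      "\<And>e. e \<in> \<A>2 \<Longrightarrow> \<exists>A B n p. interval_cell A \<and> interval_cell B \<and> good (dyadic_square n p) \<and>
       A \<times> B \<subseteq> dyadic_square n p \<and> e = S \<inter> A \<times> B"
    by (rule dyadic_partition[of S good]) blast+
  have cells2: "is_cell e \<and> tame_cell X e" if "e \<in> \<A>2" for e
  proof -
    obtain A B n p where AB: "interval_cell A" "interval_cell B" and g: "good (dyadic_square n p)"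
      and sub: "A \<times> B \<subseteq> dyadic_square n p" and e: "e = S \<inter> A \<times> B"
      using A2(5)[OF \<open>e \<in> \<A>2\<close>] by (elim exE conjE)
    have "w \<in> S" if "w \<in> X \<inter> zeros" "w \<in> A \<times> B" for w
    proof -
      have "w \<in> dyadic_square n p" using sub that by blast
      then have "good (dyadic_square n w)" using g dyadic_square_eq by simp
      then show ?thesis using that unfolding S_def by blast
    qed
    moreover have "S \<subseteq> X \<inter> zeros" by (auto simp: S_def)
    ultimately have "e = X \<inter> zeros \<inter> A \<times> B" unfolding e by blast
    then show ?thesis using g AB sub A2(3)[OF \<open>e \<in> \<A>2\<close>] unfolding good_def by blast
  qed
  define bad where "bad = X \<inter> zeros - S"
  have "z \<in> S" if z: "z \<in> X" "z \<in> zeros" "z \<notin> exceptional" for z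
  proof -
    obtain U where U: "open U" "z \<in> U"
      "\<And>A B \<delta>. \<lbrakk>interval_cell A; interval_cell B; \<delta> > 0; \<And>w. w \<in> A \<times> B \<Longrightarrow> ball w \<delta> \<subseteq> U;
         X \<inter> zeros \<inter> A \<times> B \<noteq> {}\<rbrakk> \<Longrightarrow>
       is_cell (X \<inter> zeros \<inter> A \<times> B) \<and> tame_cell X (X \<inter> zeros \<inter> A \<times> B)"
      by (rule piece_cells[OF z]) blast
    obtain n \<delta> where n: "\<delta> > 0" "\<forall>w\<in>dyadic_square n z. ball w \<delta> \<subseteq> U"
      using dyadic_square_in_open[OF U(1,2)] by (elim exE conjE)
    have "good (dyadic_square n z)"
      unfolding good_def
    proof (intro allI impI)
      fix A B
      assume "interval_cell A \<and> interval_cell B \<and> A \<times> B \<subseteq> dyadic_square n z \<and> X \<inter> zeros \<inter> A \<times> B \<noteq> {}"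
      then show "is_cell (X \<inter> zeros \<inter> A \<times> B) \<and> tame_cell X (X \<inter> zeros \<inter> A \<times> B)"
        using n by (intro U(3)[of A B \<delta>]) blast+
    qed
    then show ?thesis using z unfolding S_def by blast
  qed
  then have "bad \<subseteq> exceptional" by (auto simp: bad_def)
  then have fin: "finite bad" using finite_exceptional finite_subset by blast
  define \<A>3 where "\<A>3 = (\<lambda>p. {p}) ` bad"
  have cells3: "is_cell e \<and> tame_cell X e" if "e \<in> \<A>3" for e
  proof -
    obtain p where p: "p \<in> bad" "e = {p}" using \<open>e \<in> \<A>3\<close> by (auto simp: \<A>3_def)
    have "interval_cell {fst p}" "interval_cell {snd p}" unfolding interval_cell_def by blast+
    then have "is_cell ({fst p} \<times> {snd p})" by (rule is_cell_box)
    moreover have "{fst p} \<times> {snd p} = e" using p by auto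
    moreover have "tame_cell X e" using p by (intro tame_convex) (auto simp: bad_def)
    ultimately show ?thesis by simp
  qed
  have U3: "\<Union>\<A>3 = bad" by (auto simp: \<A>3_def)
  have SZ: "S \<subseteq> X \<inter> zeros" by (auto simp: S_def)
  have disj: "(X - zeros) \<inter> S = {}" "(X - zeros) \<inter> bad = {}" "S \<inter> bad = {}"
    using SZ by (auto simp: bad_def)
  show ?thesis
  proof (intro exI[of _ "\<A>1 \<union> \<A>2 \<union> \<A>3"] conjI ballI impI)
    show "countable (\<A>1 \<union> \<A>2 \<union> \<A>3)"
      using A1(1) A2(1) fin by (simp add: \<A>3_def countable_finite)
    show "\<Union>(\<A>1 \<union> \<A>2 \<union> \<A>3) = X"
      unfolding Union_Un_distrib A1(2) A2(2) U3 using SZ by (auto simp: bad_def)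
    fix e assume e: "e \<in> \<A>1 \<union> \<A>2 \<union> \<A>3"
    show "e \<noteq> {}" using e A1(3) A2(3) by (auto simp: \<A>3_def)
    show "is_cell e" "tame_cell X e" using e cells1 cells2 cells3 by blast+
    fix e' assume e': "e' \<in> \<A>1 \<union> \<A>2 \<union> \<A>3" and ne: "e \<noteq> e'"
    have sub: "e \<subseteq> X - zeros" if "e \<in> \<A>1" for e using A1(2) that by blast
    have sub2: "e \<subseteq> S" if "e \<in> \<A>2" for e using A2(2) that by blast
    have sub3: "e \<subseteq> bad" if "e \<in> \<A>3" for e using U3 that by blast
    have d3: "e \<inter> e' = {}" if "e \<in> \<A>3" "e' \<in> \<A>3" using that ne by (auto simp: \<A>3_def)
    from e e' show "e \<inter> e' = {}"
      using A1(4)[OF _ _ ne] A2(4)[OF _ _ ne] d3 sub[of e] sub[of e'] sub2[of e] sub2[of e'] sub3[of e] sub3[of e'] disj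
      by (elim UnE) blast+
  qed
qed

end

lemma tame_partition_decomposition:
  assumes "countable \<A>" "\<Union>\<A> = X" "\<And>e. e \<in> \<A> \<Longrightarrow> e \<noteq> {} \<and> is_cell e \<and> tame_cell X e"
    and "\<And>e e'. e \<in> \<A> \<Longrightarrow> e' \<in> \<A> \<Longrightarrow> e \<noteq> e' \<Longrightarrow> e \<inter> e' = {}"
  shows "cell_decomposition \<A> X" "finiteness_property \<A> X"
proof -
  show "cell_decomposition \<A> X" using assms unfolding cell_decomposition_def by blast
  show "finiteness_property \<A> X"
    unfolding finiteness_property_def
  proof (intro ballI allI impI, rule disjI2, intro conjI ballI)
    fix A B g e assume g: "shortest_curve X A B g" and e: "e \<in> \<A>"
    have t: "tame_cell X e" using assms(3)[OF e] by blast
    show "finite (components (path_image g \<inter> e))" using t g unfolding tame_cell_def by blast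
    fix C assume C: "C \<in> components (path_image g \<inter> e)"
    have "(\<exists>p. C = {p}) \<or> line_segment_set C \<or> one_cell e"
      using t g C unfolding tame_cell_def by blast
    moreover have "C \<subseteq> e" "connected C" "C \<noteq> {}"
      using C in_components_subset in_components_connected in_components_nonempty by blast+
    ultimately show "(\<exists>p. C = {p}) \<or> geodesic_segment \<A> C"
      using e unfolding geodesic_segment_def by (metis subset_singletonD)
  qed
qed

lemma semialgebraic_sign_invariant:
  assumes "semialgebraic X"
  obtains FF where "sign_invariant_set FF X"
proof -
  obtain I J :: nat and f g where fg: "\<forall>i<I. \<forall>j<J. poly2 (f i j) \<and> poly2 (g i j)"
    and X: "X = (\<Union>i<I. \<Inter>j<J. {p. f i j p = 0 \<and> g i j p > 0})"
    using assms unfolding semialgebraic_def by blast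
  define F where "F i j = (SOME q. f i j = ev q)" for i j
  define G where "G i j = (SOME q. g i j = ev q)" for i j
  have F: "f i j = ev (F i j)" and G: "g i j = ev (G i j)" if "i < I" "j < J" for i j
    unfolding F_def G_def using someI_ex[OF poly2_imp_ev] fg that by blast+
  \<comment> \<open>The zero polynomial is dropped because it would make \<open>zeros\<close> the
    whole plane; its sign is the same everywhere anyway.\<close>
  define FF where "FF = (\<lambda>(i, j). F i j) ` ({..<I} \<times> {..<J}) \<union> (\<lambda>(i, j). G i j) ` ({..<I} \<times> {..<J}) - {0}"
  have "sign_invariant_set FF X"
  proof
    show "finite FF" "0 \<notin> FF" by (simp_all add: FF_def)
    fix z w assume s: "\<And>q. q \<in> FF \<Longrightarrow> sgn (ev q z) = sgn (ev q w)"
    have "sgn (f i j z) = sgn (f i j w) \<and> sgn (g i j z) = sgn (g i j w)" if ij: "i < I" "j < J" for i j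
    proof -
      have "sgn (ev q z) = sgn (ev q w)" if "q = F i j \<or> q = G i j" for q
      proof (cases "q = 0")
        case False
        then have "q \<in> FF" using that ij by (auto simp: FF_def)
        then show ?thesis by (rule s)
      qed simp
      then show ?thesis using F[OF ij] G[OF ij] by simp
    qed
    then have "f i j z = 0 \<and> g i j z > 0 \<longleftrightarrow> f i j w = 0 \<and> g i j w > 0" if "i < I" "j < J" for i j
      using that by (metis sgn_0_0 sgn_greater)
    then show "z \<in> X \<longleftrightarrow> w \<in> X" unfolding X by auto
  qed
  then show thesis by (rule that)
qed

theorem theorem5p5:
  fixes X :: "(real \<times> real) set"
  assumes "semialgebraic X"
  shows "\<exists>\<A>. cell_decomposition \<A> X \<and> finiteness_property \<A> X"
proof -
  obtain FF where "sign_invariant_set FF X" using assms by (rule semialgebraic_sign_invariant)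
  then obtain \<A> where "countable \<A>" "\<Union>\<A> = X" "\<And>e. e \<in> \<A> \<Longrightarrow> e \<noteq> {} \<and> is_cell e \<and> tame_cell X e"
    "\<And>e e'. e \<in> \<A> \<Longrightarrow> e' \<in> \<A> \<Longrightarrow> e \<noteq> e' \<Longrightarrow> e \<inter> e' = {}"
    using sign_invariant_set.exists_tame_partition by metis
  from tame_partition_decomposition[OF this] show ?thesis by blast
qed

end
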